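(* $$\varepsilon(e^{-\pi})=2^{-9/8}\,3^{-3/8}\,e^{\pi/24}\,\frac{1+\sqrt3+\sqrt2\cdot 3^{3/4}}{(1+\sqrt3+\sqrt2\,\sqrt[4]{3})^{1/2}}\,\frac{\pi^{1/4}}{\Gamma(\tfrac34)},$$ $$\varepsilon(-e^{-\pi})=2^{-3/4}\,3^{-1/2}\,e^{\pi/24}\,(1+\sqrt3)(2\sqrt3-3)^{1/4}\,\frac{\pi^{1/4}}{\Gamma(\tfrac34)}.$$
   Context: For $q\in\mathbf{C}$ with $|q|<1$, $\varepsilon(q)=\sum_{k=-\infty}^{\infty}q^{k(3k+1)/2}$. $\Gamma$ is the Gamma function; all roots and fractional powers are of positive reals and denote the positive value. *)

theory Defs
  imports "HOL-Analysis.Analysis"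
begin

text \<open>
  The series converges absolutely for \<open>norm q < 1\<close>, the only range in which this value is
  meaningful. The integer division is exact, as \<open>k * (3 * k + 1)\<close> is even, and the
  exponent is nonnegative.
\<close>

definition epsilon :: "complex \<Rightarrow> complex" where
  "epsilon q = (\<Sum>\<^sub>\<infinity>k\<in>(UNIV :: int set). q powi (k * (3 * k + 1) div 2))"

end

theory Submission
  imports Defs
begin

text \<open>
  Completing the square turns both series into values of \<open>theta t x = \<Sum>n. exp (- pi * t * (n + x)\<^sup>2)\<close>
  with rational \<open>x\<close>. Substitutions in double series express products of such values in each other, and
  these relations suffice. Write \<open>\<theta>\<^sub>2, \<theta>\<^sub>3, \<theta>\<^sub>4\<close> for the theta constants as functions of \<open>t\<close>.

  The squares of \<open>\<theta>\<^sub>3\<close> and \<open>\<theta>\<^sub>4\<close> follow the arithmetic-geometric mean iteration when \<open>t\<close> is doubled. The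
  triple obtained by \<open>t \<mapsto> 1 / t\<close> obeys the same recursions with the same limits, and by monotonicity of
  the mean it is the same triple: this is the inversion formula. With Landen's transformation the
  iteration also gives \<open>\<theta>\<^sub>3 1\<close> as a Beta integral. The cubic modular equation and the quartic tetracode
  relation, combined with inversion between \<open>1 / 3\<close> and \<open>3\<close>, then determine the theta constants at
  \<open>t = 3\<close>, and the two series are algebraic functions of these.
\<close>

subsection \<open>Theta series with rational shift\<close>

text \<open>Real shifts replace Jacobi's separate functions, so that dissections and products stay
  within one family of positive series. For \<open>t \<le> 0\<close> the series diverges and the
  value is the default 0.\<close>

definition theta :: "real \<Rightarrow> real \<Rightarrow> real" where
  "theta t x = (\<Sum>\<^sub>\<infinity>n\<in>(UNIV :: int set). exp (- (pi * t * (of_int n + x)\<^sup>2)))"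

lemma int_UNIV_split: "(UNIV :: int set) = range int \<union> range (\<lambda>n. - int (Suc n))"
proof -
  have "x \<in> range int \<union> range (\<lambda>n. - int (Suc n))" for x :: int
    by (cases x) (auto simp: image_iff)
  then show ?thesis by blast
qed

lemma summable_on_int_geometric:
  fixes c :: real
  assumes "0 \<le> c" "c < 1"
  shows "(\<lambda>n::int. c ^ nat \<bar>n\<bar>) summable_on UNIV"
proof -
  have 1: "(\<lambda>n. c ^ n) summable_on (UNIV :: nat set)"
    using assms by (intro norm_summable_imp_summable_on) (auto simp: norm_power)
  have "(\<lambda>n::int. c ^ nat \<bar>n\<bar>) summable_on range int"
    by (subst summable_on_reindex) (use 1 in \<open>auto simp: o_def inj_on_def\<close>)
  moreover have "(\<lambda>n::int. c ^ nat \<bar>n\<bar>) summable_on range (\<lambda>n. - int (Suc n))"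
    by (subst summable_on_reindex)
      (use summable_on_cmult_right[OF 1, of c] in \<open>auto simp: o_def inj_on_def nat_add_distrib\<close>)
  ultimately show ?thesis
    unfolding int_UNIV_split by (rule summable_on_union)
qed

lemma summable_on_theta:
  assumes "t > 0"
  shows "(\<lambda>n::int. exp (- (pi * t * (of_int n + x)\<^sup>2))) summable_on UNIV"
proof (rule summable_on_comparison_test)
  define c where "c = exp (- (2 * pi * t))"
  have c: "0 \<le> c" "c < 1" using assms by (auto simp: c_def)
  show "(\<lambda>n::int. exp (pi * t * (2 * \<bar>x\<bar> + 1)) * c ^ nat \<bar>n\<bar>) summable_on UNIV"
    by (intro summable_on_cmult_right summable_on_int_geometric c)
  fix n :: int
  \<comment> \<open>This linear lower bound for the square replaces the Gaussian tail by a geometric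
    one.\<close>
  have "2 * \<bar>of_int n + x\<bar> - 1 \<le> (of_int n + x)\<^sup>2"
    using zero_le_power2[of "\<bar>of_int n + x\<bar> - 1"] by (simp add: power2_diff)
  moreover have "\<bar>of_int n\<bar> - \<bar>x\<bar> \<le> \<bar>of_int n + x\<bar>" by linarith
  moreover have "2 * c - 2 * d - 1 \<le> s" if "2 * a - 1 \<le> s" "c - d \<le> a" for a c d s :: real
    using that by linarith
  ultimately have "2 * \<bar>real_of_int n\<bar> - 2 * \<bar>x\<bar> - 1 \<le> (of_int n + x)\<^sup>2" by blast
  then have "pi * t * (2 * \<bar>real_of_int n\<bar> - 2 * \<bar>x\<bar> - 1) \<le> pi * t * (of_int n + x)\<^sup>2"
    using assms by (intro mult_left_mono) auto
  then have "exp (- (pi * t * (of_int n + x)\<^sup>2))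
      \<le> exp (pi * t * (2 * \<bar>x\<bar> + 1) + real (nat \<bar>n\<bar>) * (- (2 * pi * t)))"
    by (simp add: algebra_simps)
  also have "\<dots> = exp (pi * t * (2 * \<bar>x\<bar> + 1)) * c ^ nat \<bar>n\<bar>"
    unfolding c_def exp_add by (simp only: exp_of_nat_mult)
  finally show "exp (- (pi * t * (of_int n + x)\<^sup>2))
      \<le> exp (pi * t * (2 * \<bar>x\<bar> + 1)) * c ^ nat \<bar>n\<bar>" .
qed auto

lemma has_sum_theta:
  "t > 0 \<Longrightarrow> ((\<lambda>n::int. exp (- (pi * t * (of_int n + x)\<^sup>2))) has_sum theta t x) UNIV"
  unfolding theta_def by (rule has_sum_infsum[OF summable_on_theta])

lemma theta_ge_term:
  assumes "t > 0"
  shows "exp (- (pi * t * (of_int n + x)\<^sup>2)) \<le> theta t x"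
  using finite_sum_le_infsum[OF summable_on_theta[OF assms, of x], of "{n}"]
  by (simp add: theta_def)

lemma theta_pos: "t > 0 \<Longrightarrow> 0 < theta t x"
  using theta_ge_term[of t 0 x] exp_gt_zero[of "- (pi * t * (of_int 0 + x)\<^sup>2)"] by linarith

lemma theta_add1 [simp]: "theta t (x + 1) = theta t x"
  unfolding theta_def
  by (rule infsum_reindex_bij_witness[where i = "\<lambda>n. n - 1" and j = "\<lambda>n. n + 1"])
    (auto simp: algebra_simps)

lemma theta_minus [simp]: "theta t (- x) = theta t x"
  unfolding theta_def
  by (rule infsum_reindex_bij_witness[where i = uminus and j = uminus])
    (auto simp: power2_eq_square algebra_simps)

lemma theta_reflect: "x + y = 1 \<Longrightarrow> theta t x = theta t y"
  using theta_add1[of t "- y"] by (simp add: eq_diff_eq[symmetric])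

section \<open>Dissections and products of theta series\<close>

lemma has_sum_int_residues:
  fixes F :: "int \<Rightarrow> real"
  assumes "(F has_sum S) UNIV" "m > 0"
    and "\<And>r. r < m \<Longrightarrow> ((\<lambda>n. F (int m * n + int r)) has_sum P r) UNIV"
  shows "S = (\<Sum>r<m. P r)"
proof -
  have "((\<lambda>(r, n). F (int m * n + int r)) has_sum S) ({..<m} \<times> UNIV) = (F has_sum S) UNIV"
    by (rule has_sum_reindex_bij_witness[where j = "\<lambda>(r,n). int m * n + int r"
        and i = "\<lambda>k. (nat (k mod int m), k div int m)"])
      (use assms(2) in \<open>auto simp: nat_less_iff\<close>)
  with assms(1) have "((\<lambda>(r, n). F (int m * n + int r)) has_sum S) ({..<m} \<times> UNIV)" by simp
  from has_sum_SigmaD[OF this, of P] assms(3) have "(P has_sum S) {..<m}" by simp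
  then show ?thesis
    by (metis finite_lessThan infsum_finite infsumI)
qed

text \<open>Grouping the index by its residue modulo \<open>m\<close> and pulling \<open>m\<close>
  out of the square rescales \<open>t\<close> by \<open>m ^ 2\<close>.\<close>

lemma theta_dissect:
  assumes "t > 0" "m > 0"
  shows "theta t x = (\<Sum>r<m. theta ((real m)\<^sup>2 * t) ((x + real r) / real m))"
proof (rule has_sum_int_residues[OF has_sum_theta[OF assms(1)] assms(2)])
  fix r
  have "((\<lambda>n::int. exp (- (pi * ((real m)\<^sup>2 * t) * (of_int n + (x + real r) / real m)\<^sup>2)))
      has_sum theta ((real m)\<^sup>2 * t) ((x + real r) / real m)) UNIV"
    using assms by (intro has_sum_theta) auto
  moreover have "pi * ((real m)\<^sup>2 * t) * (of_int n + (x + real r) / real m)\<^sup>2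
      = pi * t * (of_int (int m * n + int r) + x)\<^sup>2" for n
  proof -
    have "of_int (int m * n + int r) + x = real m * (of_int n + (x + real r) / real m)"
      using assms by (simp add: field_simps)
    then show ?thesis by (simp only: power_mult_distrib) (simp add: mult_ac)
  qed
  ultimately show "((\<lambda>n::int. exp (- (pi * t * (of_int (int m * n + int r) + x)\<^sup>2)))
      has_sum theta ((real m)\<^sup>2 * t) ((x + real r) / real m)) UNIV"
    by simp
qed

lemma has_sum_product_real:
  fixes f g :: "int \<Rightarrow> real"
  assumes "(f has_sum a) UNIV" "(g has_sum b) UNIV" "\<And>n. f n \<ge> 0" "\<And>n. g n \<ge> 0"
  shows "((\<lambda>(m, n). f m * g n) has_sum a * b) (UNIV \<times> UNIV)"
proof (rule has_sum_SigmaI)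
  show "((\<lambda>n. (\<lambda>(m, n). f m * g n) (m, n)) has_sum f m * b) UNIV" for m
    using has_sum_cmult_right[OF assms(2), of "f m"] by simp
  show "((\<lambda>m. f m * b) has_sum a * b) UNIV"
    using has_sum_cmult_left[OF assms(1), of b] by simp
  show "(\<lambda>(m, n). f m * g n) summable_on UNIV \<times> UNIV"
  proof (rule summable_on_SigmaI)
    show "((\<lambda>n. (\<lambda>(m, n). f m * g n) (m, n)) has_sum f m * b) UNIV" for m
      using has_sum_cmult_right[OF assms(2), of "f m"] by simp
    show "(\<lambda>m. f m * b) summable_on UNIV"
      using has_sum_cmult_left[OF assms(1), of b] by (auto simp: summable_on_def)
  qed (use assms in auto)
qed

text \<open>Substitute \<open>m = p + b q + r\<close>, \<open>n = p - q\<close>, so that \<open>m - n = (b + 1) q + r\<close>; the form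
  \<open>u\<^sup>2 + b v\<^sup>2\<close> equals \<open>((u + b v)\<^sup>2 + b (u - v)\<^sup>2) / (b + 1)\<close>.\<close>

lemma theta_mult:
  assumes "t > 0" "b > 0"
  shows "theta t x * theta (real b * t) y =
    (\<Sum>r<Suc b. theta (real (Suc b) * t) ((real r + x + real b * y) / real (Suc b))
      * theta (real b * real (Suc b) * t) ((real r + x - y) / real (Suc b)))"
proof -
  define f where "f = (\<lambda>(m::int, n::int). exp (- (pi * t * (of_int m + x)\<^sup>2))
    * exp (- (pi * (real b * t) * (of_int n + y)\<^sup>2)))"
  define s where "s = real (Suc b)"
  have s: "s > 0" "real b = s - 1" by (auto simp: s_def)
  let ?A = "\<lambda>r. (real r + x + real b * y) / s"
  let ?B = "\<lambda>r. (real r + x - y) / s"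
  define g where "g = (\<lambda>(r, p, q). exp (- (pi * (s * t) * (of_int p + ?A r)\<^sup>2))
    * exp (- (pi * (real b * s * t) * (of_int q + ?B r)\<^sup>2)))"
  define h where "h = (\<lambda>(r, p, q). (p + int b * q + int r, p - q))"
  have f: "(f has_sum theta t x * theta (real b * t) y) (UNIV \<times> UNIV)"
    unfolding f_def using assms by (intro has_sum_product_real has_sum_theta) auto
  have fg: "f (h z) = g z" for z
  proof -
    obtain r p q where z: "z = (r, p, q)" by (cases z)
    define P Q where "P = of_int p + ?A r" and "Q = of_int q + ?B r"
    have "?A r + real b * ?B r = real r + x" "?A r - ?B r = y"
      unfolding s(2) using s(1) by (simp_all add: field_simps)
    then have 1: "of_int (p + int b * q + int r) + x = P + real b * Q"
      and 2: "of_int (p - q) + y = P - Q"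
      unfolding P_def Q_def by (simp_all add: algebra_simps)
    have "t * (P + real b * Q)\<^sup>2 + (real b * t) * (P - Q)\<^sup>2 = s * t * P\<^sup>2 + real b * s * t * Q\<^sup>2"
      unfolding s(2) by (simp add: power2_eq_square algebra_simps)
    then have "pi * (t * (P + real b * Q)\<^sup>2 + (real b * t) * (P - Q)\<^sup>2)
        = pi * (s * t * P\<^sup>2 + real b * s * t * Q\<^sup>2)" by simp
    then show ?thesis
      unfolding z f_def h_def g_def prod.case 1 2 P_def[symmetric] Q_def[symmetric]
      by (simp add: exp_add[symmetric] algebra_simps)
  qed
  \<comment> \<open>\<open>k\<close> inverts \<open>h\<close>: since
    \<open>m - n = (b + 1) q + r\<close>, division with remainder recovers \<open>q\<close> and
    \<open>r\<close>, and then \<open>p = n + q\<close>.\<close>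
  define k where "k = (\<lambda>(m::int, n::int). (nat ((m - n) mod int (Suc b)),
      n + (m - n) div int (Suc b), (m - n) div int (Suc b)))"
  have "(g has_sum theta t x * theta (real b * t) y) ({..<Suc b} \<times> UNIV \<times> UNIV)
    = (f has_sum theta t x * theta (real b * t) y) (UNIV \<times> UNIV)"
  proof (rule has_sum_reindex_bij_witness[where i = k and j = h])
    fix z assume z: "z \<in> {..<Suc b} \<times> (UNIV::int set) \<times> (UNIV::int set)"
    then obtain r p q where rpq: "z = (r, p, q)" "r < Suc b" by auto
    have e: "p + int b * q + int r - (p - q) = int r + q * int (Suc b)"
      by (simp add: algebra_simps)
    have dm: "(int r + q * int (Suc b)) div int (Suc b) = q"
      "(int r + q * int (Suc b)) mod int (Suc b) = int r"
      using rpq by simp_all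
    show "k (h z) = z"
      unfolding rpq h_def k_def prod.case e dm by simp
    show "f (h z) = g z" by (rule fg)
  next
    fix w :: "int \<times> int"
    obtain m n where w: "w = (m, n)" by (cases w)
    define d where "d = m - n"
    have *: "(d mod int (Suc b)) \<ge> 0" "d mod int (Suc b) < int (Suc b)"
      "int (Suc b) * (d div int (Suc b)) + d mod int (Suc b) = d" by simp_all
    then show "k w \<in> {..<Suc b} \<times> UNIV \<times> UNIV"
      unfolding w k_def prod.case d_def[symmetric]
      by (simp add: nat_less_iff)
    have "n + d div int (Suc b) + int b * (d div int (Suc b)) + d mod int (Suc b) = n + d"
      using *(3) by (simp add: algebra_simps)
    then show "h (k w) = w"
      unfolding w k_def h_def prod.case d_def[symmetric] using *(1) by (simp add: d_def)
  qed auto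
  with f have "(g has_sum theta t x * theta (real b * t) y) ({..<Suc b} \<times> UNIV \<times> UNIV)" by simp
  moreover have "((\<lambda>pq. g (r, pq)) has_sum theta (s * t) (?A r) * theta (real b * s * t) (?B r))
      (UNIV \<times> UNIV)" for r
  proof -
    have "((\<lambda>(p, q). exp (- (pi * (s * t) * (of_int p + ?A r)\<^sup>2))
      * exp (- (pi * (real b * s * t) * (of_int q + ?B r)\<^sup>2))) has_sum
      theta (s * t) (?A r) * theta (real b * s * t) (?B r)) (UNIV \<times> UNIV)"
      using assms s by (intro has_sum_product_real has_sum_theta) auto
    then show ?thesis by (simp add: g_def)
  qed
  ultimately have "((\<lambda>r. theta (s * t) (?A r) * theta (real b * s * t) (?B r)) has_sum
      theta t x * theta (real b * t) y) {..<Suc b}"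
    by (intro has_sum_SigmaD[of g]) auto
  then show ?thesis
    unfolding s_def by (metis (no_types, lifting) finite_lessThan infsum_finite infsumI)
qed

subsection \<open>Theta constants and their algebraic relations\<close>

abbreviation theta3 :: "real \<Rightarrow> real" where "theta3 t \<equiv> theta t 0"
abbreviation theta2 :: "real \<Rightarrow> real" where "theta2 t \<equiv> theta t (1/2)"

text \<open>Separating even and odd \<open>n\<close>, this is \<open>\<Sum>n. (-1)\<^sup>n * exp (- pi * t * n\<^sup>2)\<close>.\<close>

definition theta4 :: "real \<Rightarrow> real" where "theta4 t = theta3 (4 * t) - theta2 (4 * t)"

lemma theta_mult_same:
  assumes "t > 0"
  shows "theta t x * theta t y =
    theta (2 * t) ((x + y) / 2) * theta (2 * t) ((x - y) / 2)
    + theta (2 * t) ((1 + x + y) / 2) * theta (2 * t) ((1 + x - y) / 2)"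
  using theta_mult[OF assms, of 1 x y] by simp

lemma theta3_sq: "t > 0 \<Longrightarrow> (theta3 t)\<^sup>2 = (theta3 (2 * t))\<^sup>2 + (theta2 (2 * t))\<^sup>2"
  using theta_mult_same[of t 0 0] by (simp add: power2_eq_square)

lemma theta2_sq: "t > 0 \<Longrightarrow> (theta2 t)\<^sup>2 = 2 * theta3 (2 * t) * theta2 (2 * t)"
  using theta_mult_same[of t "1/2" "1/2"] theta_add1[of "2 * t" 0]
  by (simp add: power2_eq_square)

lemma theta_dissect2: "t > 0 \<Longrightarrow> theta t x = theta (4 * t) (x / 2) + theta (4 * t) ((x + 1) / 2)"
  using theta_dissect[of t 2 x] by (simp add: numeral_2_eq_2)

lemma theta_dissect3:
  "t > 0 \<Longrightarrow> theta t x = theta (9 * t) (x / 3) + theta (9 * t) ((x + 1) / 3) + theta (9 * t) ((x + 2) / 3)"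
  using theta_dissect[of t 3 x] by (simp add: numeral_3_eq_3)

lemma theta3_dissect: "t > 0 \<Longrightarrow> theta3 t = theta3 (4 * t) + theta2 (4 * t)"
  using theta_dissect2[of t 0] by simp

lemma theta2_dissect: "t > 0 \<Longrightarrow> theta2 t = 2 * theta (4 * t) (1/4)"
  using theta_dissect2[of t "1/2"] theta_reflect[of "3/4" "1/4" "4 * t"] by simp

lemma theta4_sq: "t > 0 \<Longrightarrow> (theta4 t)\<^sup>2 = (theta3 (2 * t))\<^sup>2 - (theta2 (2 * t))\<^sup>2"
  using theta3_sq[of "2 * t"] theta2_sq[of "2 * t"] by (simp add: theta4_def power2_diff)

text \<open>The difference of squares from \<open>theta4_sq\<close> factors over
  \<open>4 * t\<close> into \<open>theta3 t\<close> and \<open>theta4 t\<close>. This is the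
  geometric mean step.\<close>

lemma theta4_double: "t > 0 \<Longrightarrow> (theta4 (2 * t))\<^sup>2 = theta3 t * theta4 t"
  using theta4_sq[of "2 * t"] theta3_dissect[of t]
  by (simp add: theta4_def power2_eq_square algebra_simps)

text \<open>Jacobi's identity. With \<open>p\<close>, \<open>q\<close> for \<open>theta3\<close>,
  \<open>theta2\<close> at \<open>2 * t\<close> it is the Pythagorean identity for
  \<open>2 p q\<close>, \<open>p ^ 2 - q ^ 2\<close> and \<open>p ^ 2 + q ^ 2\<close>.\<close>

lemma theta_quartic:
  assumes "t > 0"
  shows "theta2 t ^ 4 + theta4 t ^ 4 = theta3 t ^ 4"
proof -
  have 4: "x ^ 4 = (x\<^sup>2)\<^sup>2" for x :: real by simp
  show ?thesis
    unfolding 4 theta2_sq[OF assms] theta3_sq[OF assms] theta4_sq[OF assms]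
    by (simp add: power2_eq_square algebra_simps)
qed

text \<open>Legendre's modular equation of degree 3. The product rule with \<open>b = 3\<close> has
  four terms at \<open>4 * t\<close> and \<open>12 * t\<close>, where \<open>theta3\<close> and
  \<open>theta4\<close> are sum and difference of the same two values.\<close>

lemma theta_cubic_modular:
  assumes "t > 0"
  shows "theta2 t * theta2 (3 * t) + theta4 t * theta4 (3 * t) = theta3 t * theta3 (3 * t)"
proof -
  have "theta2 t * theta2 (3 * t) = theta2 (4 * t) * theta3 (12 * t)
      + 2 * theta (4 * t) (1/4) * theta (12 * t) (1/4) + theta3 (4 * t) * theta2 (12 * t)"
    using theta_mult[OF assms, of 3 "1/2" "1/2"] theta_reflect[of "3/4" "1/4" "4 * t"]
      theta_reflect[of "3/4" "1/4" "12 * t"] theta_add1[of "4 * t" 0] theta_add1[of "4 * t" "1/4"]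
    by (simp add: numeral_3_eq_3)
  \<comment> \<open>The two odd residues reproduce half of the left-hand side, so the expansion can
    be solved for it.\<close>
  moreover have "2 * theta (4 * t) (1/4) * theta (12 * t) (1/4) = theta2 t * theta2 (3 * t) / 2"
    using assms by (simp add: theta2_dissect)
  ultimately show ?thesis
    using theta3_dissect[OF assms] theta3_dissect[of "3 * t"] assms
    by (simp add: theta4_def algebra_simps)
qed

text \<open>The identity counts vectors in the lattice over the ternary tetracode, which is \<open>\<surd>3\<close> times a
  copy of the lattice of integer quadruples.\<close>

lemma theta_tetracode:
  assumes "t > 0"
  shows "theta3 (3 * t) ^ 4 = theta3 (9 * t) ^ 4 + 8 * theta3 (9 * t) * theta (9 * t) (1/3) ^ 3"
proof -
  define A T a0 a1 b0 b1 where "A = theta3 (9 * t)" and "T = theta (9 * t) (1/3)"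
    and "a0 = theta3 (18 * t)" and "a1 = theta (18 * t) (1/3)"
    and "b0 = theta2 (18 * t)" and "b1 = theta (18 * t) (1/6)"
  note defs = A_def T_def a0_def a1_def b0_def b1_def
  have r: "theta s (2/3) = theta s (1/3)" "theta s (5/6) = theta s (1/6)" "theta s 1 = theta s 0"
    "theta s (-1/6) = theta s (1/6)" for s
    using theta_minus[of s "1/6"] by (auto intro: theta_reflect)
  have 1: "theta3 (3 * t) * theta3 (6 * t) = A * a0 + 2 * T * a1"
    using theta_mult[of "3 * t" 2 0 0] assms by (simp add: defs r numeral_2_eq_2)
  have 2: "theta3 (3 * t) * theta2 (6 * t) = A * b0 + 2 * T * b1"
    using theta_mult[of "3 * t" 2 0 "1/2"] assms by (simp add: defs r numeral_2_eq_2)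
  have A: "A\<^sup>2 = a0\<^sup>2 + b0\<^sup>2" using theta3_sq[of "9 * t"] assms by (simp add: defs)
  have T: "T\<^sup>2 = a0 * a1 + b0 * b1"
    using theta_mult_same[of "9 * t" "1/3" "1/3"] assms by (simp add: defs r power2_eq_square)
  have AT: "A * T = a1\<^sup>2 + b1\<^sup>2"
    using theta_mult_same[of "9 * t" "2/3" 0] assms by (simp add: defs r power2_eq_square mult.commute)
  have "theta3 (3 * t) ^ 4 = (theta3 (3 * t))\<^sup>2 * (theta3 (3 * t))\<^sup>2"
    by (simp add: power2_eq_square power4_eq_xxxx)
  \<comment> \<open>One factor is split by \<open>theta3_sq\<close>, so the fourth power becomes a
    sum of two squares of the products 1 and 2. Expanded, these are quadratic expressions that
    recombine through \<open>A\<close>, \<open>T\<close> and \<open>AT\<close>.\<close>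
  also have "\<dots> = (theta3 (3 * t) * theta3 (6 * t))\<^sup>2 + (theta3 (3 * t) * theta2 (6 * t))\<^sup>2"
    by (subst (2) theta3_sq) (use assms in \<open>auto simp: power_mult_distrib algebra_simps\<close>)
  also have "\<dots> = A\<^sup>2 * (a0\<^sup>2 + b0\<^sup>2) + 4 * A * T * (a0 * a1 + b0 * b1) + 4 * T\<^sup>2 * (a1\<^sup>2 + b1\<^sup>2)"
    unfolding 1 2 by (simp add: power2_eq_square algebra_simps)
  also have "\<dots> = A ^ 4 + 8 * A * T ^ 3"
    unfolding A[symmetric] T[symmetric] AT[symmetric]
    by (simp add: power2_eq_square power4_eq_xxxx power3_eq_cube)
  finally show ?thesis by (simp add: defs)
qed

text \<open>As a sum over positive \<open>m\<close> this is the theta series of the even quadratic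
  character modulo 8 at \<open>exp (- pi * t * m ^ 2 / 64)\<close>: residues 1, 7 count positively,
  3, 5 negatively.\<close>

definition theta_eighth :: "real \<Rightarrow> real" where
  "theta_eighth t = theta t (1/8) - theta t (3/8)"

text \<open>Squares and cross product, expanded over \<open>16 * t\<close>, combine into a product
  of two factors. Dissection recognises these as \<open>theta2 t / 2\<close> and
  \<open>theta4 t\<close>.\<close>

lemma theta_eighth_sq:
  assumes "t > 0"
  shows "(theta_eighth (8 * t))\<^sup>2 = theta2 t * theta4 t / 2"
proof -
  have r: "theta s (5/8) = theta s (3/8)" "theta s (7/8) = theta s (1/8)"
    "theta s (9/8) = theta s (1/8)" "theta s (3/4) = theta s (1/4)" "theta s (-1/4) = theta s (1/4)" for s
    using theta_minus[of s "1/4"] theta_add1[of s "1/8"] by (auto intro: theta_reflect)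
  let ?a = "theta (16 * t)"
  have 1: "(theta (8 * t) (1/8))\<^sup>2 = ?a (1/8) * ?a 0 + ?a (3/8) * ?a (1/2)"
    using theta_mult_same[of "8 * t" "1/8" "1/8"] assms by (simp add: r power2_eq_square)
  have 2: "(theta (8 * t) (5/8))\<^sup>2 = ?a (3/8) * ?a 0 + ?a (1/8) * ?a (1/2)"
    using theta_mult_same[of "8 * t" "5/8" "5/8"] assms by (simp add: r(1-4) power2_eq_square)
  have 3: "theta (8 * t) (1/8) * theta (8 * t) (5/8) = (?a (1/8) + ?a (3/8)) * ?a (1/4)"
    using theta_mult_same[of "8 * t" "1/8" "5/8"] assms by (simp add: r algebra_simps)
  have 4: "?a (1/8) + ?a (3/8) = theta2 t / 2"
    using theta_dissect2[of "4 * t" "1/4"] theta2_dissect[of t] assms by (simp add: r)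
  have 5: "?a 0 + ?a (1/2) - 2 * ?a (1/4) = theta4 t"
    using theta3_dissect[of "4 * t"] theta2_dissect[of "4 * t"] assms by (simp add: theta4_def)
  have "(theta_eighth (8 * t))\<^sup>2 = (theta (8 * t) (1/8) - theta (8 * t) (5/8))\<^sup>2"
    by (simp add: theta_eighth_def r)
  also have "\<dots> = (?a (1/8) + ?a (3/8)) * (?a 0 + ?a (1/2) - 2 * ?a (1/4))"
    unfolding power2_diff 1 2 mult.assoc 3 by (simp add: algebra_simps)
  finally show ?thesis unfolding 4 5 by simp
qed

text \<open>A difference of two squares over \<open>2 * t\<close>. It serves to carry positivity of
  \<open>theta_eighth\<close> from \<open>2 * t\<close> down to \<open>t\<close>.\<close>

lemma theta_eighth_double:
  assumes "t > 0"
  shows "theta_eighth t * (theta t (1/8) + theta t (3/8)) = theta_eighth (2 * t) * theta4 (t / 2)"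
proof -
  have r: "theta s (5/8) = theta s (3/8)" "theta s (7/8) = theta s (1/8)" for s
    by (auto intro: theta_reflect)
  let ?a = "theta (2 * t)"
  have 1: "(theta t (1/8))\<^sup>2 = ?a (1/8) * ?a 0 + ?a (3/8) * ?a (1/2)"
    using theta_mult_same[of t "1/8" "1/8"] assms by (simp add: r power2_eq_square)
  have 2: "(theta t (3/8))\<^sup>2 = ?a (3/8) * ?a 0 + ?a (1/8) * ?a (1/2)"
    using theta_mult_same[of t "3/8" "3/8"] assms by (simp add: r power2_eq_square)
  have "theta_eighth t * (theta t (1/8) + theta t (3/8)) = (theta t (1/8))\<^sup>2 - (theta t (3/8))\<^sup>2"
    by (simp add: theta_eighth_def power2_eq_square algebra_simps)
  then show ?thesis
    unfolding 1 2 by (simp add: theta_eighth_def theta4_def algebra_simps)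
qed

text \<open>In the threefold dissection of shifts \<open>1/8\<close> and \<open>3/8\<close> the
  terms with denominator 8 come back exchanged, which accounts for the plus sign before
  \<open>theta_eighth (9 * t)\<close>.\<close>

lemma theta_24:
  assumes "t > 0"
  shows "theta (9 * t) (1/24) + theta (9 * t) (7/24) - theta (9 * t) (5/24) - theta (9 * t) (11/24)
    = theta_eighth t + theta_eighth (9 * t)"
proof -
  have r: "theta s (17/24) = theta s (7/24)" "theta s (19/24) = theta s (5/24)" for s
    by (auto intro: theta_reflect)
  show ?thesis
    using theta_dissect3[OF assms, of "1/8"] theta_dissect3[OF assms, of "3/8"]
    by (simp add: theta_eighth_def r)
qed

subsection \<open>Behaviour at infinity and at zero\<close>

text \<open>Split \<open>t\<close> as \<open>(t - 1) + 1\<close>: the first part is estimated by the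
  smallest square, the second sums to the constant \<open>theta 1 x\<close>.\<close>

lemma theta_decay:
  assumes "t \<ge> 1" "\<And>n::int. c \<le> (of_int n + x)\<^sup>2"
  shows "theta t x \<le> exp (- (pi * (t - 1) * c)) * theta 1 x"
proof (rule has_sum_mono[OF has_sum_theta has_sum_cmult_right[OF has_sum_theta]])
  fix n :: int
  have "pi * (t - 1) * c \<le> pi * (t - 1) * (of_int n + x)\<^sup>2"
    using assms by (intro mult_left_mono) auto
  then show "exp (- (pi * t * (of_int n + x)\<^sup>2))
      \<le> exp (- (pi * (t - 1) * c)) * exp (- (pi * 1 * (of_int n + x)\<^sup>2))"
    by (simp add: exp_add[symmetric] algebra_simps)
qed (use assms in auto)

lemma int_add_sq_ge:
  fixes a x :: real
  assumes "0 \<le> a" "a \<le> x" "x \<le> 1 - a"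
  shows "a\<^sup>2 \<le> (of_int n + x)\<^sup>2"
proof (cases "n \<ge> 0")
  case True
  then have "0 \<le> real_of_int n" by simp
  from add_increasing[OF this assms(2)] have "a \<le> of_int n + x" .
  then show ?thesis using assms(1) by (rule power_mono)
next
  case False
  then have "real_of_int n \<le> real_of_int (- 1)" by (simp only: of_int_le_iff)
  then have "real_of_int n \<le> - 1" by simp
  with assms(3) have "a \<le> - (of_int n + x)" by linarith
  then have "a\<^sup>2 \<le> (- (of_int n + x))\<^sup>2" using assms(1) by (rule power_mono)
  then show ?thesis by (simp only: power2_minus)
qed

lemma exp_decay_tendsto:
  assumes "c > 0"
  shows "((\<lambda>t. exp (- (pi * (t - 1) * c)) * C) \<longlongrightarrow> 0) at_top"
proof -
  have "filterlim (\<lambda>t. pi * c * (- 1 + t)) at_top at_top"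
    using assms by (intro filterlim_tendsto_pos_mult_at_top[OF tendsto_const]
        filterlim_tendsto_add_at_top[OF tendsto_const filterlim_ident]) auto
  then have "((\<lambda>t. exp (- (pi * c * (- 1 + t)))) \<longlongrightarrow> 0) at_top"
    by (intro filterlim_compose[OF exp_at_bot]) (simp add: filterlim_uminus_at_bot)
  moreover have "pi * c * (- 1 + t) = pi * (t - 1) * c" for t
    by (simp add: algebra_simps)
  ultimately have "((\<lambda>t. exp (- (pi * (t - 1) * c))) \<longlongrightarrow> 0) at_top" by (simp only:)
  then show ?thesis by (rule tendsto_mult_left_zero)
qed

lemma theta3_tendsto: "(theta3 \<longlongrightarrow> 1) at_top"
proof (rule tendsto_sandwich[OF _ _ tendsto_const])
  show "\<forall>\<^sub>F t in at_top. theta3 t \<le> 1 + exp (- (pi * (t - 1) * 1)) * theta3 1"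
    using eventually_ge_at_top[of 1]
  proof eventually_elim
    case (elim t)
    have one: "((\<lambda>n::int. if n = 0 then 1 else 0 :: real) has_sum 1) UNIV"
      by (rule has_sum_finite_neutralI[of "{0}"]) auto
    show ?case
    proof (rule has_sum_mono[OF has_sum_theta has_sum_add[OF one has_sum_cmult_right[OF has_sum_theta]]])
      fix n :: int
      show "exp (- (pi * t * (of_int n + 0)\<^sup>2))
        \<le> (if n = 0 then 1 else 0) + exp (- (pi * (t - 1) * 1)) * exp (- (pi * 1 * (of_int n + 0)\<^sup>2))"
      proof (cases "n = 0")
        case False
        then have "1 \<le> \<bar>real_of_int n\<bar>" by linarith
        then have "1 \<le> (real_of_int n)\<^sup>2" by (metis abs_le_square_iff abs_one one_power2)
        then have "pi * (t - 1) * 1 \<le> pi * (t - 1) * (real_of_int n)\<^sup>2"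
          using elim by (intro mult_left_mono) auto
        then show ?thesis using False by (simp add: exp_add[symmetric] algebra_simps)
      qed auto
    qed (use elim in auto)
  qed
  show "\<forall>\<^sub>F t in at_top. 1 \<le> theta3 t"
    using eventually_gt_at_top[of 0]
  proof eventually_elim
    case (elim t)
    then show ?case using theta_ge_term[of t 0 0] by simp
  qed
  show "((\<lambda>t. 1 + exp (- (pi * (t - 1) * 1)) * theta3 1) \<longlongrightarrow> 1) at_top"
    using tendsto_add[OF tendsto_const exp_decay_tendsto, of 1 1] by simp
qed

lemma theta2_tendsto: "(theta2 \<longlongrightarrow> 0) at_top"
proof (rule tendsto_sandwich[OF _ _ tendsto_const])
  show "\<forall>\<^sub>F t in at_top. theta2 t \<le> exp (- (pi * (t - 1) * (1/2)\<^sup>2)) * theta2 1"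
    using eventually_ge_at_top[of 1]
    by eventually_elim (rule theta_decay, auto intro!: int_add_sq_ge)
  show "\<forall>\<^sub>F t in at_top. 0 \<le> theta2 t"
    using eventually_gt_at_top[of 0]
    by eventually_elim (rule less_imp_le[OF theta_pos])
  show "((\<lambda>t. exp (- (pi * (t - 1) * (1/2)\<^sup>2)) * theta2 1) \<longlongrightarrow> 0) at_top"
    by (rule exp_decay_tendsto) auto
qed

lemma theta4_tendsto: "(theta4 \<longlongrightarrow> 1) at_top"
proof -
  have 4: "filterlim (\<lambda>t::real. 4 * t) at_top at_top"
    by (intro filterlim_tendsto_pos_mult_at_top[OF tendsto_const]) (auto simp: filterlim_ident)
  show ?thesis
    using tendsto_diff[OF filterlim_compose[OF theta3_tendsto 4] filterlim_compose[OF theta2_tendsto 4]]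
    by (simp add: theta4_def[abs_def])
qed

section \<open>The Gaussian integral and the behaviour at zero\<close>

lemma has_integral_Ioi_iff_Ici:
  fixes f :: "real \<Rightarrow> real"
  shows "(f has_integral I) {0<..} \<longleftrightarrow> (f has_integral I) {0..}"
proof (rule has_integral_spike_set_eq)
  show "negligible {x \<in> {0<..} - {0..}. f x \<noteq> 0}" "negligible {x \<in> {0..} - {0<..}. f x \<noteq> 0}"
    by (rule negligible_subset[of "{0}"]; auto)+
qed

text \<open>The substitution \<open>pi * u * x ^ 2\<close> turns the Gamma integral at
  \<open>1/2\<close> into this one.\<close>

lemma has_integral_gaussian:
  assumes "u > 0"
  shows "((\<lambda>x. exp (- (pi * u * x\<^sup>2))) has_integral 1 / (2 * sqrt u)) {0..}"
proof -
  let ?F = "\<lambda>t::real. t powr (1/2 - 1) / exp t" and ?g = "\<lambda>x::real. pi * u * x\<^sup>2"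
  define k where "k = 2 * sqrt (pi * u)"
  have k: "k > 0" "k\<^sup>2 = 4 * (pi * u)" using assms by (auto simp: k_def power_mult_distrib)
  have "?g ` {0<..} = {0<..}"
  proof (intro equalityI subsetI)
    fix y :: real assume "y \<in> {0<..}"
    then show "y \<in> ?g ` {0<..}"
      using assms by (intro image_eqI[of _ _ "sqrt (y / (pi * u))"]) auto
  qed (use assms in auto)
  moreover have "(?F has_integral Gamma (1/2)) {0<..}"
    unfolding has_integral_Ioi_iff_Ici by (rule Gamma_integral_real) simp
  moreover from this have "?F absolutely_integrable_on {0<..}"
    by (intro nonnegative_absolutely_integrable_1) (auto simp: has_integral_iff)
  ultimately have *: "?F absolutely_integrable_on (?g ` {0<..}) \<and> integral (?g ` {0<..}) ?F = sqrt pi"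
    by (simp add: has_integral_iff Gamma_one_half_real)
  have der: "(?g has_field_derivative 2 * (pi * u * x)) (at x within {0<..})" for x
    by (auto intro!: derivative_eq_intros)
  have inj: "inj_on ?g {0<..}" using assms by (auto simp: inj_on_def)
  have "(\<lambda>x. \<bar>2 * (pi * u * x)\<bar> * ?F (?g x)) absolutely_integrable_on {0<..} \<and>
      integral {0<..} (\<lambda>x. \<bar>2 * (pi * u * x)\<bar> * ?F (?g x)) = sqrt pi"
    using has_absolute_integral_change_of_variables_1'[OF _ der inj, of ?F "sqrt pi"] * by simp
  then have "((\<lambda>x. \<bar>2 * (pi * u * x)\<bar> * ?F (?g x)) has_integral sqrt pi) {0<..}"
    by (auto simp: has_integral_iff absolutely_integrable_on_def)
  moreover have "\<bar>2 * (pi * u * x)\<bar> * ?F (?g x) = k * exp (- (pi * u * x\<^sup>2))" if "x \<in> {0<..}" for x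
  proof -
    define m where "m = sqrt (pi * u) * x"
    have m: "m > 0" "?g x = m\<^sup>2" using that assms by (auto simp: m_def power_mult_distrib)
    have "\<bar>2 * (pi * u * x)\<bar> = k * m"
      using that assms by (simp add: k_def m_def)
    moreover have "(?g x) powr (1/2 - 1) = inverse m"
      unfolding m(2) using m(1) by (simp add: powr_minus powr_half_sqrt)
    ultimately show ?thesis
      using m(1) by (simp add: exp_minus field_simps)
  qed
  ultimately have "((\<lambda>x. k * exp (- (pi * u * x\<^sup>2))) has_integral sqrt pi) {0<..}"
    by (rule has_integral_eq[rotated])
  from has_integral_mult_right[OF this, of "1 / k"] have "((\<lambda>x. exp (- (pi * u * x\<^sup>2))) has_integral sqrt pi / k) {0<..}"
    using k by simp
  moreover have "sqrt pi / k = 1 / (2 * sqrt u)"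
    using assms by (simp add: k_def real_sqrt_mult)
  ultimately show ?thesis
    by (simp add: has_integral_Ioi_iff_Ici)
qed

lemma filterlim_two_power_mult:
  fixes t :: real
  assumes "t > 0"
  shows "filterlim (\<lambda>n. 2 ^ n * t) at_top sequentially"
proof -
  have "filterlim (\<lambda>n. (2::real) ^ n) at_top sequentially"
    by (rule filterlim_at_infinity_imp_filterlim_at_top[OF filterlim_realpow_sequentially_gt1]) auto
  then show ?thesis
    using assms by (intro filterlim_at_top_mult_tendsto_pos[OF tendsto_const])
qed

text \<open>Integral test: the sum \<open>S\<close> over \<open>n \<ge> 0\<close> of a decreasing
  function exceeds its integral by an amount between 0 and the first term 1. Since
  \<open>theta3 u = 2 * S - 1\<close>, the error lies between -1 and 1.\<close>

lemma theta3_approx: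
  assumes u: "u > 0"
  shows "\<bar>theta3 u - 1 / sqrt u\<bar> \<le> 1"
proof -
  define f where "f = (\<lambda>x::real. exp (- (pi * u * x\<^sup>2)))"
  interpret antimono_fun_sum_integral_diff f
  proof
    show "f y \<le> f x" if "0 \<le> x" "x \<le> y" for x y
      unfolding f_def using that u by (simp add: mult_left_mono power_mono)
    show "continuous_on {0..} f" unfolding f_def by (intro continuous_intros)
  qed (auto simp: f_def)
  have sm: "(\<lambda>n::int. f (of_int n)) summable_on A" for A
    unfolding f_def
    by (rule summable_on_subset_banach[OF _ subset_UNIV]) (use summable_on_theta[OF u, of 0] in simp)
  have "(\<lambda>n. f (real n)) summable_on UNIV"
    using sm[of "range int"] by (subst (asm) summable_on_reindex) (auto simp: o_def)
  then obtain S where S: "((\<lambda>n. f (real n)) has_sum S) UNIV"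
    by (auto simp: summable_on_def)
  then have sums: "(\<lambda>n. f (real n)) sums S" by (rule has_sum_imp_sums)
  have nonneg: "((\<lambda>n::int. f (of_int n)) has_sum S) (range int)"
    using S by (subst has_sum_reindex) (auto simp: o_def)
  have "(\<lambda>n. f (real (Suc n))) sums (S - 1)"
    using sums_split_initial_segment[OF sums, of 1] by (simp add: f_def)
  then have "((\<lambda>n. f (real (Suc n))) has_sum (S - 1)) UNIV"
    by (rule sums_nonneg_imp_has_sum) (simp add: f_def)
  moreover have "f (of_int (- int (Suc n))) = f (real (Suc n))" for n
    by (simp add: f_def power2_eq_square algebra_simps)
  ultimately have neg: "((\<lambda>n::int. f (of_int n)) has_sum (S - 1)) (range (\<lambda>n. - int (Suc n)))"
    by (subst has_sum_reindex) (auto simp: o_def inj_on_def)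
  have "((\<lambda>n::int. f (of_int n)) has_sum (S + (S - 1))) UNIV"
    unfolding int_UNIV_split 
  proof (rule has_sum_Un_disjoint[OF nonneg neg])
    have "int m \<noteq> - int (Suc n)" for m n by linarith
    then show "range int \<inter> range (\<lambda>n. - int (Suc n)) = {}" by blast
  qed
  from infsumI[OF this] have th: "theta3 u = 2 * S - 1"
    unfolding theta_def f_def by simp
  have hi: "(f has_integral 1 / (2 * sqrt u)) {0..}"
    unfolding f_def by (rule has_integral_gaussian[OF u])
  then have ai: "f absolutely_integrable_on {0..}"
    by (intro nonnegative_absolutely_integrable_1) (auto simp: has_integral_iff f_def)
  have "((\<lambda>b. LINT x:{0..b}|lebesgue. f x) \<longlongrightarrow> (LINT x:{0..}|lebesgue. f x)) at_top"
    using ai by (intro tendsto_set_lebesgue_integral_at_top) auto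
  moreover have "(LINT x:{0..}|lebesgue. f x) = 1 / (2 * sqrt u)"
    using set_lebesgue_integral_eq_integral(2)[OF ai] hi by (simp add: has_integral_iff)
  moreover have "(LINT x:{0..b}|lebesgue. f x) = integral {0..b} f" for b
    by (rule set_lebesgue_integral_eq_integral(2)[OF set_integrable_subset[OF ai]]) auto
  ultimately have "((\<lambda>b. integral {0..b} f) \<longlongrightarrow> 1 / (2 * sqrt u)) at_top" by simp
  then have "(\<lambda>n. integral {0..real n} f) \<longlonglongrightarrow> 1 / (2 * sqrt u)"
    by (rule filterlim_compose[OF _ filterlim_real_sequentially])
  then have lim: "sum_integral_diff_series \<longlonglongrightarrow> S - 1 / (2 * sqrt u)"
    unfolding sum_integral_diff_series_def[abs_def]
    using sums by (intro tendsto_diff) (simp_all add: sums_def_le)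
  have "S - 1 / (2 * sqrt u) \<ge> 0"
    by (rule LIMSEQ_le_const[OF lim]) (use sum_integral_diff_series_nonneg in auto)
  moreover have "sum_integral_diff_series n \<le> 1" for n
  proof -
    \<comment> \<open>At index 0 the partial sum already contains the term \<open>f 0 = 1\<close>,
      while the integral is empty.\<close>
    have "sum_integral_diff_series 0 = 1"
      unfolding sum_integral_diff_series_def by (simp add: f_def)
    then show ?thesis using sum_integral_diff_series_antimono[of 0 n] by simp
  qed
  then have "S - 1 / (2 * sqrt u) \<le> 1"
    by (intro LIMSEQ_le_const2[OF lim]) auto
  ultimately show ?thesis by (simp add: th)
qed

lemma theta3_tendsto_0: "((\<lambda>u. u * (theta3 u)\<^sup>2) \<longlongrightarrow> 1) (at_right 0)"
proof -
  have s: "((\<lambda>u. sqrt u) \<longlongrightarrow> 0) (at_right 0)"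
    using tendsto_real_sqrt[of "\<lambda>u::real. u" 0 "at_right 0"] by (simp add: tendsto_ident_at)
  have "((\<lambda>u. sqrt u * theta3 u - 1) \<longlongrightarrow> 0) (at_right 0)"
  proof (rule Lim_null_comparison[OF _ s])
    show "\<forall>\<^sub>F u in at_right 0. norm (sqrt u * theta3 u - 1) \<le> sqrt u"
      using eventually_at_right_less
    proof eventually_elim
      case (elim u)
      have "norm (sqrt u * theta3 u - 1) = \<bar>sqrt u * (theta3 u - 1 / sqrt u)\<bar>"
        using elim by (simp add: algebra_simps)
      also have "\<dots> = sqrt u * \<bar>theta3 u - 1 / sqrt u\<bar>"
        using elim by (simp add: abs_mult)
      also have "\<dots> \<le> sqrt u * 1"
        using elim by (intro mult_left_mono theta3_approx) auto
      finally show ?case by simp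
    qed
  qed
  then have "((\<lambda>u. sqrt u * theta3 u) \<longlongrightarrow> 1) (at_right 0)"
    by (rule LIM_zero_cancel)
  from tendsto_power[OF this, of 2]
  have "((\<lambda>u. (sqrt u * theta3 u)\<^sup>2) \<longlongrightarrow> 1) (at_right 0)" by simp
  moreover have "\<forall>\<^sub>F u in at_right 0. (sqrt u * theta3 u)\<^sup>2 = u * (theta3 u)\<^sup>2"
    using eventually_at_right_less by eventually_elim (simp add: power_mult_distrib)
  ultimately show ?thesis by (rule Lim_transform_eventually)
qed

subsection \<open>The inversion formula\<close>

text \<open>The squares of the three theta constants obey Gauss's arithmetic-geometric recursion when
  \<open>t\<close> is doubled, and also (in \<open>f\<close> and \<open>h\<close>) when \<open>t\<close> is halved. Together with the limits at both
  ends this determines them.\<close>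

locale agm_triple =
  fixes f g h :: "real \<Rightarrow> real"
  assumes pos: "\<And>t. t > 0 \<Longrightarrow> f t > 0"
    and nonneg: "\<And>t. t > 0 \<Longrightarrow> g t \<ge> 0" "\<And>t. t > 0 \<Longrightarrow> h t \<ge> 0"
    and arith_double: "\<And>t. t > 0 \<Longrightarrow> f (2 * t) = (f t + g t) / 2"
    and geom_double: "\<And>t. t > 0 \<Longrightarrow> (g (2 * t))\<^sup>2 = f t * g t"
    and arith_half: "\<And>t. t > 0 \<Longrightarrow> f (t / 2) = f t + h t"
    and geom_half: "\<And>t. t > 0 \<Longrightarrow> (h (t / 2))\<^sup>2 = 4 * (f t * h t)"
    and pythagoras: "\<And>t. t > 0 \<Longrightarrow> (g t)\<^sup>2 + (h t)\<^sup>2 = (f t)\<^sup>2"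
    and tendsto_inf: "(f \<longlongrightarrow> 1) at_top"
    and tendsto_0: "((\<lambda>t. t * f t) \<longlongrightarrow> 1) (at_right 0)"
begin

lemma tendsto_double:
  assumes "t > 0"
  shows "(\<lambda>n. f (2 ^ n * t)) \<longlonglongrightarrow> 1"
  by (rule filterlim_compose[OF tendsto_inf filterlim_two_power_mult[OF assms]])

lemma tendsto_half:
  assumes "t > 0"
  shows "(\<lambda>n. f (t / 2 ^ n) / 2 ^ n) \<longlonglongrightarrow> 1 / t"
proof -
  have "(\<lambda>n. t / 2 ^ n) \<longlonglongrightarrow> 0"
    by (rule LIMSEQ_divide_realpow_zero) simp
  then have "filterlim (\<lambda>n. t / 2 ^ n) (at_right 0) sequentially"
    using assms by (intro filterlim_at_withinI) (auto simp: eventually_sequentially)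
  from filterlim_compose[OF tendsto_0 this]
  have "(\<lambda>n. t / 2 ^ n * f (t / 2 ^ n) / t) \<longlonglongrightarrow> 1 / t"
    by (intro tendsto_divide) (use assms in auto)
  then show ?thesis using assms by simp
qed

end

text \<open>Let \<open>c = F t / f t\<close>. Means are monotone and homogeneous, so doubling keeps
  \<open>c * f\<close> and \<open>c * g\<close> below \<open>F\<close> and \<open>G\<close>, and the
  limit at infinity gives \<open>c \<le> 1\<close>. By Pythagoras the order is reversed for
  \<open>h\<close>, and halving with the limit at zero gives \<open>c \<ge> 1\<close>.\<close>

lemma agm_triple_compare:
  assumes "agm_triple f g h" "agm_triple F G H" and t: "t > 0" and le: "g t * F t \<le> G t * f t"
  shows "f t = F t"
proof -
  interpret a: agm_triple f g h by fact
  interpret A: agm_triple F G H by fact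
  define c where "c = F t / f t"
  have c: "c > 0" using a.pos[OF t] A.pos[OF t] by (simp add: c_def)
  have cf: "c * f t = F t" using a.pos[OF t] by (simp add: c_def)
  have cg: "c * g t \<le> G t" using le a.pos[OF t] by (simp add: c_def field_simps)
  have up: "c * f (2 ^ n * t) \<le> F (2 ^ n * t) \<and> c * g (2 ^ n * t) \<le> G (2 ^ n * t)" for n
  proof (induction n)
    case (Suc n)
    define s where "s = 2 ^ n * t"
    have s: "s > 0" using t by (simp add: s_def)
    have IH: "c * f s \<le> F s" "c * g s \<le> G s" using Suc by (auto simp: s_def)
    have "c * f (2 * s) \<le> F (2 * s)"
      using IH unfolding a.arith_double[OF s] A.arith_double[OF s] by (simp add: algebra_simps)
    moreover have "(c * g (2 * s))\<^sup>2 \<le> (G (2 * s))\<^sup>2"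
    proof -
      have "(c * g (2 * s))\<^sup>2 = (c * f s) * (c * g s)"
        unfolding power_mult_distrib a.geom_double[OF s] by (simp add: power2_eq_square)
      also have "\<dots> \<le> F s * G s"
        using IH c a.pos[OF s] A.pos[OF s] a.nonneg(1)[OF s] by (intro mult_mono) auto
      finally show ?thesis unfolding A.geom_double[OF s] .
    qed
    then have "c * g (2 * s) \<le> G (2 * s)"
      by (rule power2_le_imp_le) (use A.nonneg s in auto)
    ultimately show ?case by (simp add: s_def mult.assoc)
  qed (use cf cg in auto)
  have "c * 1 \<le> 1"
    by (rule LIMSEQ_le[OF tendsto_mult[OF tendsto_const a.tendsto_double[OF t]] A.tendsto_double[OF t]])
      (use up in auto)
  \<comment> \<open>At \<open>t\<close> itself the scaled triples have equal hypotenuse, so the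
    larger \<open>G\<close> forces the smaller \<open>H\<close>.\<close>
  have "(c * g t)\<^sup>2 \<le> (G t)\<^sup>2"
    using cg c a.nonneg(1)[OF t] by (intro power_mono) auto
  moreover have "(c * g t)\<^sup>2 + (c * h t)\<^sup>2 = (G t)\<^sup>2 + (H t)\<^sup>2"
    unfolding A.pythagoras[OF t] cf[symmetric] power_mult_distrib distrib_left[symmetric]
      a.pythagoras[OF t] ..
  ultimately have "(H t)\<^sup>2 \<le> (c * h t)\<^sup>2" by linarith
  then have ch: "H t \<le> c * h t"
    by (rule power2_le_imp_le) (use c a.nonneg(2)[OF t] in auto)
  have down: "F (t / 2 ^ n) \<le> c * f (t / 2 ^ n) \<and> H (t / 2 ^ n) \<le> c * h (t / 2 ^ n)" for n
  proof (induction n)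
    case (Suc n)
    define s where "s = t / 2 ^ n"
    have s: "s > 0" "s / 2 > 0" using t by (simp_all add: s_def)
    have IH: "F s \<le> c * f s" "H s \<le> c * h s" using Suc by (auto simp: s_def)
    have "F (s / 2) \<le> c * f (s / 2)"
      using IH unfolding a.arith_half[OF s(1)] A.arith_half[OF s(1)] by (simp add: algebra_simps)
    moreover have "(H (s / 2))\<^sup>2 \<le> (c * h (s / 2))\<^sup>2"
    proof -
      have "F s * H s \<le> (c * f s) * (c * h s)"
        using IH c a.pos[OF s(1)] A.pos[OF s(1)] A.nonneg(2)[OF s(1)] by (intro mult_mono) auto
      then show ?thesis
        unfolding power_mult_distrib a.geom_half[OF s(1)] A.geom_half[OF s(1)]
        by (simp add: power2_eq_square mult_ac)
    qed
    then have "H (s / 2) \<le> c * h (s / 2)"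
      by (rule power2_le_imp_le) (use a.nonneg(2)[OF s(2)] c in auto)
    ultimately show ?case by (simp add: s_def mult.commute)
  qed (use cf ch in auto)
  have "1 / t \<le> c * (1 / t)"
  proof (rule LIMSEQ_le[OF A.tendsto_half[OF t] tendsto_mult[OF tendsto_const a.tendsto_half[OF t]]])
    show "\<exists>N. \<forall>n\<ge>N. F (t / 2 ^ n) / 2 ^ n \<le> c * (f (t / 2 ^ n) / 2 ^ n)"
      using down by (simp add: divide_right_mono)
  qed
  then have "c \<ge> 1" using t by (simp add: field_simps)
  with \<open>c * 1 \<le> 1\<close> have "c = 1" by simp
  then show ?thesis using cf by simp
qed

text \<open>At \<open>t\<close> the two ratios \<open>g / f\<close> and \<open>G / F\<close> are
  comparable, so one of the two comparisons applies.\<close>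

lemma agm_triple_unique:
  assumes "agm_triple f g h" "agm_triple F G H" "t > 0"
  shows "f t = F t"
  using agm_triple_compare[OF assms] agm_triple_compare[OF assms(2,1,3)]
  by (metis linorder_le_cases)

lemma agm_triple_theta: "agm_triple (\<lambda>t. (theta3 t)\<^sup>2) (\<lambda>t. (theta4 t)\<^sup>2) (\<lambda>t. (theta2 t)\<^sup>2)"
proof
  fix t :: real assume t: "t > 0"
  show "(theta3 t)\<^sup>2 > 0" using theta_pos[OF t, of 0] by simp
  show "(theta3 (2 * t))\<^sup>2 = ((theta3 t)\<^sup>2 + (theta4 t)\<^sup>2) / 2"
    using theta3_sq[OF t] theta4_sq[OF t] by simp
  show "((theta4 (2 * t))\<^sup>2)\<^sup>2 = (theta3 t)\<^sup>2 * (theta4 t)\<^sup>2"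
    unfolding theta4_double[OF t] by (simp add: power_mult_distrib)
  show "(theta3 (t / 2))\<^sup>2 = (theta3 t)\<^sup>2 + (theta2 t)\<^sup>2"
    using theta3_sq[of "t / 2"] t by simp
  show "((theta2 (t / 2))\<^sup>2)\<^sup>2 = 4 * ((theta3 t)\<^sup>2 * (theta2 t)\<^sup>2)"
    using theta2_sq[of "t / 2"] t by (simp add: power_mult_distrib)
  show "((theta4 t)\<^sup>2)\<^sup>2 + ((theta2 t)\<^sup>2)\<^sup>2 = ((theta3 t)\<^sup>2)\<^sup>2"
    using theta_quartic[OF t] by simp
next
  show "((\<lambda>t. (theta3 t)\<^sup>2) \<longlongrightarrow> 1) at_top"
    using tendsto_power[OF theta3_tendsto, of 2] by simp
qed (use theta3_tendsto_0 in auto)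

text \<open>Passing to \<open>1 / t\<close> exchanges doubling with halving, hence \<open>g\<close>
  with \<open>h\<close>. The factor \<open>1 / t\<close> absorbs the factor 2 between the two
  recursions and exchanges the limits at both ends.\<close>

lemma agm_triple_dual:
  assumes "agm_triple f g h"
  shows "agm_triple (\<lambda>t. f (1 / t) / t) (\<lambda>t. h (1 / t) / t) (\<lambda>t. g (1 / t) / t)"
proof -
  interpret agm_triple f g h by fact
  show ?thesis
  proof
    fix t :: real assume t: "t > 0"
    define s where "s = 1 / t"
    have s: "s > 0" "1 / (2 * t) = s / 2" "1 / (t / 2) = 2 * s" "t = 1 / s"
      using t by (auto simp: s_def)
    note [simp] = s(2,3)
    show "f (1 / t) / t > 0" "h (1 / t) / t \<ge> 0" "g (1 / t) / t \<ge> 0"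
      using t pos nonneg by auto
    show "f (1 / (2 * t)) / (2 * t) = (f (1 / t) / t + h (1 / t) / t) / 2"
      using arith_half[OF s(1)] t unfolding s(2) s_def[symmetric] by (simp add: field_simps)
    show "(h (1 / (2 * t)) / (2 * t))\<^sup>2 = f (1 / t) / t * (h (1 / t) / t)"
      using geom_half[OF s(1)] t unfolding s(2) s_def[symmetric]
      by (simp add: power_divide power_mult_distrib power2_eq_square)
    show "f (1 / (t / 2)) / (t / 2) = f (1 / t) / t + g (1 / t) / t"
      using arith_double[OF s(1)] t unfolding s(3) s_def[symmetric] by (simp add: field_simps)
    show "(g (1 / (t / 2)) / (t / 2))\<^sup>2 = 4 * (f (1 / t) / t * (g (1 / t) / t))"
      using geom_double[OF s(1)] t unfolding s(3) s_def[symmetric]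
      by (simp add: power_divide power_mult_distrib power2_eq_square)
    show "(h (1 / t) / t)\<^sup>2 + (g (1 / t) / t)\<^sup>2 = (f (1 / t) / t)\<^sup>2"
      using pythagoras[OF s(1)] unfolding s_def[symmetric] power_divide
      by (simp add: add_divide_distrib[symmetric] add.commute)
  next
    have "filterlim (\<lambda>t::real. 1 / t) (at_right 0) at_top"
      using filterlim_inverse_at_right_top by (simp add: inverse_eq_divide)
    from filterlim_compose[OF tendsto_0 this]
    show "((\<lambda>t. f (1 / t) / t) \<longlongrightarrow> 1) at_top" by simp
    have "filterlim (\<lambda>t::real. 1 / t) at_top (at_right 0)"
      using filterlim_inverse_at_top_right by (simp add: inverse_eq_divide)
    from filterlim_compose[OF tendsto_inf this]
    show "((\<lambda>t. t * (f (1 / t) / t)) \<longlongrightarrow> 1) (at_right 0)"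
      by (rule Lim_transform_eventually)
        (use eventually_at_right_less in \<open>rule eventually_mono, auto\<close>)
  qed
qed

lemma theta3_inverse:
  assumes "t > 0"
  shows "theta3 (1 / t) = sqrt t * theta3 t"
proof -
  have "(theta3 t)\<^sup>2 = (theta3 (1 / t))\<^sup>2 / t"
    using agm_triple_unique[OF agm_triple_theta agm_triple_dual[OF agm_triple_theta] assms] .
  then have "(theta3 (1 / t))\<^sup>2 = (sqrt t * theta3 t)\<^sup>2"
    using assms by (simp add: power_mult_distrib field_simps)
  moreover have "theta3 (1 / t) \<ge> 0" "sqrt t * theta3 t \<ge> 0"
    using assms theta_pos[of t 0] theta_pos[of "1 / t" 0] by auto
  ultimately show ?thesis by (simp add: power2_eq_iff_nonneg)
qed

text \<open>Dissection expresses \<open>theta2\<close> at \<open>1 / t\<close> through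
  \<open>theta3\<close> alone, to which the inversion applies twice.\<close>

lemma theta2_inverse:
  assumes t: "t > 0"
  shows "theta2 (1 / t) = sqrt t * theta4 t"
proof -
  have "theta2 (1 / t) = theta3 (1 / (4 * t)) - theta3 (1 / t)"
    using theta3_dissect[of "1 / (4 * t)"] t by simp
  also have "\<dots> = sqrt t * (2 * theta3 (4 * t) - theta3 t)"
    using theta3_inverse[OF t] theta3_inverse[of "4 * t"] t
    by (simp add: real_sqrt_mult algebra_simps)
  also have "\<dots> = sqrt t * theta4 t"
    using theta3_dissect[OF t] by (simp add: theta4_def)
  finally show ?thesis .
qed

lemma theta4_inverse: "t > 0 \<Longrightarrow> theta4 (1 / t) = sqrt t * theta2 t"
  using theta2_inverse[of "1 / t"] by (simp add: real_sqrt_divide field_simps)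

text \<open>Not visible from the alternating series; inversion turns it into the positivity of a
  series of positive terms.\<close>

lemma theta4_pos: "t > 0 \<Longrightarrow> 0 < theta4 t"
  using theta2_inverse[of t] theta_pos[of "1 / t" "1/2"] by (simp add: zero_less_mult_iff)

text \<open>For large argument the leading term of shift \<open>1/8\<close> dominates;
  \<open>theta_eighth_double\<close> then descends from \<open>2 ^ n * t\<close> to
  \<open>t\<close>. Positivity later fixes the sign of a square root.\<close>

lemma theta_eighth_pos:
  assumes t: "t > 0"
  shows "0 < theta_eighth t"
proof -
  \<comment> \<open>Since \<open>(3/8) ^ 2 = 1/64 + 1/8\<close>, the factor \<open>?E\<close> can be
    split off, and \<open>e\<close> completes it to the term \<open>n = 0\<close> of shift
    \<open>1/8\<close>.\<close>
  define e where "e = exp (- (pi / 64))"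
  have "((\<lambda>s. exp (- (pi * (s - 1) * (1/8))) * theta 1 (3/8)) \<longlongrightarrow> 0) at_top"
    by (rule exp_decay_tendsto) auto
  then have "\<forall>\<^sub>F s in at_top. exp (- (pi * (s - 1) * (1/8))) * theta 1 (3/8) < e"
    by (rule order_tendstoD) (simp add: e_def)
  then have ev: "\<forall>\<^sub>F s in at_top. 0 < theta_eighth s"
    using eventually_ge_at_top[of 1]
  proof eventually_elim
    case (elim s)
    let ?E = "exp (- (pi * (s - 1) * (1/64)))"
    have "theta s (3/8) \<le> exp (- (pi * (s - 1) * (3/8)\<^sup>2)) * theta 1 (3/8)"
      using elim by (intro theta_decay int_add_sq_ge) auto
    also have "\<dots> = ?E * (exp (- (pi * (s - 1) * (1/8))) * theta 1 (3/8))"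
      by (simp add: exp_add[symmetric] power2_eq_square algebra_simps)
    also have "\<dots> < ?E * e"
      using elim by (intro mult_strict_left_mono) auto
    also have "\<dots> = exp (- (pi * s * (of_int 0 + 1/8)\<^sup>2))"
      by (simp add: e_def exp_add[symmetric] power2_eq_square algebra_simps)
    also have "\<dots> \<le> theta s (1/8)"
      using elim by (intro theta_ge_term) auto
    finally show ?case by (simp add: theta_eighth_def)
  qed
  from eventually_compose_filterlim[OF ev filterlim_two_power_mult[OF t]]
  obtain n where "0 < theta_eighth (2 ^ n * t)"
    by (auto simp: eventually_sequentially)
  then show ?thesis
  proof (induction n)
    case (Suc n)
    define s where "s = 2 ^ n * t"
    have s: "s > 0" using t by (simp add: s_def)
    have "0 < theta_eighth (2 * s) * theta4 (s / 2)"
      using Suc.prems s by (intro mult_pos_pos theta4_pos) (auto simp: s_def mult.assoc)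
    then have "0 < theta_eighth s"
      unfolding theta_eighth_double[OF s, symmetric]
      using theta_pos[OF s, of "1/8"] theta_pos[OF s, of "3/8"] by (simp add: zero_less_mult_iff)
    then show ?case using Suc.IH by (simp add: s_def)
  qed simp
qed

subsection \<open>Landen's transformation and the value at 1\<close>

lemma has_integral_nonneg_iff:
  fixes f :: "real \<Rightarrow> real"
  assumes "\<And>x. x \<in> S \<Longrightarrow> f x \<ge> 0"
  shows "(f has_integral b) S \<longleftrightarrow> f absolutely_integrable_on S \<and> integral S f = b"
  using nonnegative_absolutely_integrable_1[of f S, OF _ assms]
  by (auto simp: has_integral_iff absolutely_integrable_on_def)

text \<open>For nonnegative integrands integrability and absolute integrability agree, so the value
  transfers in both directions.\<close>

lemma has_integral_change_of_variables_nonneg: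
  fixes f g g' :: "real \<Rightarrow> real"
  assumes "S \<in> sets lebesgue"
    and "\<And>x. x \<in> S \<Longrightarrow> (g has_field_derivative g' x) (at x within S)"
    and "inj_on g S" "g ` S = T" "\<And>y. y \<in> T \<Longrightarrow> f y \<ge> 0"
  shows "((\<lambda>x. \<bar>g' x\<bar> * f (g x)) has_integral b) S \<longleftrightarrow> (f has_integral b) T"
proof -
  have "((\<lambda>x. \<bar>g' x\<bar> * f (g x)) has_integral b) S \<longleftrightarrow>
      (\<lambda>x. \<bar>g' x\<bar> * f (g x)) absolutely_integrable_on S \<and> integral S (\<lambda>x. \<bar>g' x\<bar> * f (g x)) = b"
    using assms(4,5) by (intro has_integral_nonneg_iff) auto
  also have "\<dots> \<longleftrightarrow> f absolutely_integrable_on (g ` S) \<and> integral (g ` S) f = b"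
    using assms(1-3) by (rule has_absolute_integral_change_of_variables_1')
  also have "\<dots> \<longleftrightarrow> (f has_integral b) T"
    unfolding assms(4) using assms(5) by (rule has_integral_nonneg_iff[symmetric])
  finally show ?thesis .
qed

lemma has_integral_even_half:
  fixes f :: "real \<Rightarrow> real"
  assumes f: "(f has_integral 2 * v) UNIV" and nonneg: "\<And>x. f x \<ge> 0" and even: "\<And>x. f (- x) = f x"
  shows "(f has_integral v) {0<..}"
proof -
  have "f absolutely_integrable_on UNIV"
    using f nonneg by (simp add: has_integral_nonneg_iff)
  then have "f absolutely_integrable_on {0<..}"
    by (rule set_integrable_subset) auto
  then obtain w where w: "(f has_integral w) {0<..}"
    by (auto simp: absolutely_integrable_on_def integrable_on_def)
  have "((\<lambda>x. \<bar>- 1\<bar> * f (- x)) has_integral w) {0<..} \<longleftrightarrow> (f has_integral w) {..<0}"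
  proof (rule has_integral_change_of_variables_nonneg)
    show "uminus ` {0<..} = {..<0::real}"
      by (auto simp: image_iff intro!: bexI[of _ "- _"])
  qed (use nonneg in \<open>auto intro!: derivative_eq_intros\<close>)
  with w even have w': "(f has_integral w) {..<0}" by simp
  have "(f has_integral (w + w)) ({..<0} \<union> {0<..})"
  proof (rule has_integral_Un[OF w' w])
    have "{..<0} \<inter> {0<..} = ({} :: real set)" by auto
    then show "negligible ({..<0} \<inter> {0<..} :: real set)" by simp
  qed
  moreover have "(f has_integral (w + w)) ({..<0} \<union> {0<..}) \<longleftrightarrow> (f has_integral (w + w)) UNIV"
  proof (rule has_integral_spike_set_eq)
    have "negligible {0::real}" by simp
    then show "negligible {x \<in> UNIV - ({..<0} \<union> {0<..}). f x \<noteq> 0}"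
      by (rule negligible_subset) auto
  qed simp
  ultimately have "w + w = 2 * v"
    using f by (metis has_integral_unique)
  with w show ?thesis by simp
qed

text \<open>Landen's transformation, with the substitution \<open>t = (x - r / x) / 2\<close>.\<close>

lemma has_integral_landen:
  fixes r s v :: real
  assumes r: "r > 0" and s: "s + 2 * r > 0"
    and v: "((\<lambda>x. 1 / sqrt (x ^ 4 + s * x\<^sup>2 + r\<^sup>2)) has_integral v) {0<..}"
  shows "((\<lambda>t. 1 / sqrt ((t\<^sup>2 + r) * (t\<^sup>2 + (s + 2 * r) / 4))) has_integral v) {0<..}"
proof (rule has_integral_even_half)
  let ?f = "\<lambda>t. 1 / sqrt ((t\<^sup>2 + r) * (t\<^sup>2 + (s + 2 * r) / 4))"
  let ?g = "\<lambda>x. (x - r / x) / 2" and ?g' = "\<lambda>x. (1 + r / x\<^sup>2) / 2"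
  have "((\<lambda>x. \<bar>?g' x\<bar> * ?f (?g x)) has_integral 2 * v) {0<..} \<longleftrightarrow> (?f has_integral 2 * v) UNIV"
  proof (rule has_integral_change_of_variables_nonneg)
    show "(?g has_field_derivative ?g' x) (at x within {0<..})" if "x \<in> {0<..}" for x
      using that by (auto intro!: derivative_eq_intros simp: field_simps power2_eq_square)
    show "inj_on ?g {0<..}"
    proof (rule strict_mono_on_imp_inj_on, rule strict_mono_onI)
      fix x y :: real assume "x \<in> {0<..}" "y \<in> {0<..}" "x < y"
      then have "r / y < r / x" using r by (intro divide_strict_left_mono) auto
      with \<open>x < y\<close> show "?g x < ?g y" by simp
    qed
    show "?g ` {0<..} = UNIV"
    proof (intro equalityI subsetI UNIV_I)
      fix t :: real
      \<comment> \<open>The positive root of \<open>x ^ 2 - 2 * t * x - r = 0\<close>.\<close>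
      define x where "x = t + sqrt (t\<^sup>2 + r)"
      have "\<bar>t\<bar> < sqrt (t\<^sup>2 + r)" using r by (intro real_less_rsqrt) auto
      then have x: "x > 0" by (simp add: x_def)
      have "(sqrt (t\<^sup>2 + r))\<^sup>2 = t\<^sup>2 + r" using r by simp
      then have "x * x - r = 2 * t * x"
        by (simp add: x_def power2_eq_square algebra_simps)
      then have "t = ?g x" using x by (simp add: field_simps)
      then show "t \<in> ?g ` {0<..}" using x by blast
    qed
  qed (use r s in auto)
  moreover have "\<bar>?g' x\<bar> * ?f (?g x) = 2 * (1 / sqrt (x ^ 4 + s * x\<^sup>2 + r\<^sup>2))" if "x \<in> {0<..}" for x
  proof -
    have x: "x > 0" using that by simp
    define q where "q = x ^ 4 + s * x\<^sup>2 + r\<^sup>2"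
    have "q = (x\<^sup>2 - r)\<^sup>2 + (s + 2 * r) * x\<^sup>2"
      by (simp add: q_def power2_eq_square power4_eq_xxxx algebra_simps)
    then have q: "q > 0" using s x by (simp add: add_nonneg_pos)
    \<comment> \<open>The first factor becomes a perfect square whose root cancels against the
      derivative of the substitution; the second becomes the quartic \<open>q\<close> up to a
      square.\<close>
    have "(?g x)\<^sup>2 + r = ((x\<^sup>2 + r) / (2 * x))\<^sup>2"
      using x by (simp add: power2_eq_square field_simps)
    moreover have "(?g x)\<^sup>2 + (s + 2 * r) / 4 = q / (2 * x)\<^sup>2"
      using x by (simp add: q_def power2_eq_square power4_eq_xxxx field_simps)
    ultimately have 1: "sqrt (((?g x)\<^sup>2 + r) * ((?g x)\<^sup>2 + (s + 2 * r) / 4))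
        = (x\<^sup>2 + r) / (2 * x) * (sqrt q / (2 * x))"
      using x r by (simp add: real_sqrt_mult real_sqrt_divide)
    have 2: "\<bar>?g' x\<bar> = (x\<^sup>2 + r) / (2 * x\<^sup>2)" using x r by (simp add: field_simps)
    have "A / (2 * x\<^sup>2) * (1 / (A / (2 * x) * (Q / (2 * x)))) = 2 * (1 / Q)"
      if "A > 0" "Q > 0" for A Q :: real
      using that x by (simp add: field_simps power2_eq_square)
    moreover have "x\<^sup>2 + r > 0" "sqrt q > 0" using r q by (auto simp: add_nonneg_pos)
    ultimately show ?thesis
      unfolding q_def[symmetric] 1 2 by blast
  qed
  then have "((\<lambda>x. \<bar>?g' x\<bar> * ?f (?g x)) has_integral 2 * v) {0<..}"
    by (intro has_integral_eq[OF _ has_integral_mult_right[OF v, of 2]]) auto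
  ultimately show "(?f has_integral 2 * v) UNIV" by blast
qed (use r s in auto)

text \<open>Substitute \<open>c * tan x\<close>. This is the case of equal parameters, in which the
  mean iteration ends.\<close>

lemma has_integral_inverse_square:
  fixes c :: real
  assumes c: "c > 0"
  shows "((\<lambda>x. 1 / (x\<^sup>2 + c\<^sup>2)) has_integral pi / (2 * c)) {0<..}"
proof -
  let ?f = "\<lambda>x. 1 / (x\<^sup>2 + c\<^sup>2)" and ?g = "\<lambda>x. c * tan x" and ?g' = "\<lambda>x. c * inverse ((cos x)\<^sup>2)"
  have cos: "cos x > 0" if "x \<in> {0<..<pi/2}" for x :: real
    using that by (intro cos_gt_zero) auto
  have "((\<lambda>x. \<bar>?g' x\<bar> * ?f (?g x)) has_integral pi / (2 * c)) {0<..<pi/2}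
    \<longleftrightarrow> (?f has_integral pi / (2 * c)) {0<..}"
  proof (rule has_integral_change_of_variables_nonneg)
    show "(?g has_field_derivative ?g' x) (at x within {0<..<pi/2})" if "x \<in> {0<..<pi/2}" for x
      using cos[OF that] by (auto intro!: derivative_eq_intros)
    show "inj_on ?g {0<..<pi/2}"
      by (rule strict_mono_on_imp_inj_on, rule strict_mono_onI) (use c in \<open>auto intro!: tan_monotone\<close>)
    show "?g ` {0<..<pi/2} = {0<..}"
    proof (intro equalityI subsetI)
      fix y :: real assume "y \<in> {0<..}"
      then have y: "y / c > 0" using c by simp
      then have "arctan (y / c) \<in> {0<..<pi/2}"
        using arctan_ubound[of "y / c"] by simp
      moreover have "y = ?g (arctan (y / c))" using c by (simp add: tan_arctan)
      ultimately show "y \<in> ?g ` {0<..<pi/2}" by blast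
    next
      fix y assume "y \<in> ?g ` {0<..<pi/2}"
      then obtain x where "0 < x" "x < pi / 2" "y = ?g x" by auto
      then show "y \<in> {0<..}" using mult_pos_pos[OF c tan_gt_zero[of x]] by simp
    qed
  qed (use c in auto)
  moreover have "\<bar>?g' x\<bar> * ?f (?g x) = 1 / c" if "x \<in> {0<..<pi/2}" for x
  proof -
    have "(?g x)\<^sup>2 + c\<^sup>2 = c\<^sup>2 * (1 + (tan x)\<^sup>2)"
      by (simp add: power_mult_distrib algebra_simps)
    also have "1 + (tan x)\<^sup>2 = inverse ((cos x)\<^sup>2)"
      using tan_sec[of x] cos[OF that] by (simp add: power_inverse)
    finally have eq: "(?g x)\<^sup>2 + c\<^sup>2 = c\<^sup>2 * inverse ((cos x)\<^sup>2)" .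
    show ?thesis
      unfolding eq using cos[OF that] c by (simp add: field_simps power2_eq_square)
  qed
  moreover have "((\<lambda>x. 1 / c) has_integral pi / (2 * c)) {0<..<pi/2}"
    using has_integral_const_real[of "1 / c" 0 "pi / 2"] c by (simp add: has_integral_Icc_iff_Ioo)
  then have "((\<lambda>x. \<bar>?g' x\<bar> * ?f (?g x)) has_integral pi / (2 * c)) {0<..<pi/2}"
    using calculation(2) by (subst has_integral_cong[where g = "\<lambda>x. 1 / c"]) auto
  ultimately show ?thesis by blast
qed

text \<open>The substitution \<open>u = x ^ 4 / (x ^ 4 + 1)\<close> leads to the Beta integral with
  both parameters \<open>1/4\<close>.\<close>

lemma has_integral_quartic:
  "((\<lambda>x::real. 1 / sqrt (x ^ 4 + 1)) has_integral Beta (1/4) (1/4) / 4) {0<..}"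
proof -
  let ?f = "\<lambda>u::real. u powr (1/4 - 1) * (1 - u) powr (1/4 - 1)"
  let ?g = "\<lambda>x::real. x ^ 4 / (x ^ 4 + 1)" and ?g' = "\<lambda>x::real. 4 * x ^ 3 / (x ^ 4 + 1)\<^sup>2"
  have q: "x ^ 4 + 1 > 0" for x :: real by (simp add: add_nonneg_pos)
  have "((\<lambda>x. \<bar>?g' x\<bar> * ?f (?g x)) has_integral Beta (1/4) (1/4)) {0<..}
    \<longleftrightarrow> (?f has_integral Beta (1/4) (1/4)) {0<..<1}"
  proof (rule has_integral_change_of_variables_nonneg)
    show "(?g has_field_derivative ?g' x) (at x within {0<..})" for x
      using q[of x] by (auto intro!: derivative_eq_intros simp: field_simps power2_eq_square)
    have g: "?g x = 1 - 1 / (x ^ 4 + 1)" for x using q[of x] by (simp add: field_simps)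
    show "inj_on ?g {0<..}"
    proof (rule strict_mono_on_imp_inj_on, rule strict_mono_onI)
      fix x y :: real assume xy: "x \<in> {0<..}" "y \<in> {0<..}" "x < y"
      then have "x ^ 4 < y ^ 4" by (intro power_strict_mono) auto
      then have "1 / (y ^ 4 + 1) < 1 / (x ^ 4 + 1)"
        using q by (intro divide_strict_left_mono) auto
      then show "?g x < ?g y" unfolding g by simp
    qed
    show "?g ` {0<..} = {0<..<1}"
    proof (intro equalityI subsetI)
      fix u :: real assume u: "u \<in> {0<..<1}"
      define x where "x = root 4 (u / (1 - u))"
      have "x > 0" "x ^ 4 = u / (1 - u)" using u by (auto simp: x_def)
      moreover from this have "x ^ 4 + 1 = 1 / (1 - u)" using u by (simp add: field_simps)
      ultimately have "x > 0" "u = ?g x" using u by simp_all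
      then show "u \<in> ?g ` {0<..}" by blast
    next
      fix u assume "u \<in> ?g ` {0<..}"
      then show "u \<in> {0<..<1}" using q by auto
    qed
  qed auto
  moreover have "(?f has_integral Beta (1/4) (1/4)) {0<..<1}"
    using has_integral_Beta_real[of "1/4" "1/4"] unfolding has_integral_Icc_iff_Ioo by simp
  moreover have "\<bar>?g' x\<bar> * ?f (?g x) = 4 * (1 / sqrt (x ^ 4 + 1))" if "x \<in> {0<..}" for x
  proof -
    have x: "x > 0" using that by simp
    define w where "w = x ^ 4 + 1"
    have w: "w > 0" using q[of x] by (simp add: w_def)
    have "1 - ?g x = 1 / w" using w unfolding w_def by (simp add: field_simps)
    then have "?f (?g x) = (x ^ 4 / w * (1 / w)) powr (- (3/4))"
      using x w unfolding w_def[symmetric] by (subst powr_mult) auto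
    also have "x ^ 4 / w * (1 / w) = x powr 4 * w powr (- 2)"
      using x w by (simp add: powr_minus power2_eq_square field_simps)
    also have "\<dots> powr (- (3/4)) = (x powr 4) powr (- (3/4)) * (w powr (- 2)) powr (- (3/4))"
      by (rule powr_mult)
    also have "\<dots> = x powr (- 3) * w powr (3/2)"
      unfolding powr_powr by simp
    also have "w powr (3/2) = w * sqrt w"
      using w powr_add[of w 1 "1/2"] by (simp add: powr_half_sqrt)
    finally have "?f (?g x) = w * sqrt w / x ^ 3"
      using x by (simp add: powr_minus field_simps)
    moreover have "\<bar>?g' x\<bar> = 4 * x ^ 3 / w\<^sup>2" using x by (simp add: w_def)
    moreover have "sqrt w * sqrt w = w" "sqrt w > 0" using w by auto
    ultimately show ?thesis
      using x w unfolding w_def[symmetric] by (simp add: field_simps power2_eq_square)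
  qed
  ultimately have "((\<lambda>x::real. 4 * (1 / sqrt (x ^ 4 + 1))) has_integral Beta (1/4) (1/4)) {0<..}"
    by (subst has_integral_cong[where g = "\<lambda>x. \<bar>?g' x\<bar> * ?f (?g x)"]) auto
  from has_integral_mult_right[OF this, of "1/4"] show ?thesis by simp
qed

lemma has_integral_quartic_scaled:
  fixes c :: real
  assumes c: "c > 0"
  shows "((\<lambda>x. 1 / sqrt (x ^ 4 + (c\<^sup>2)\<^sup>2)) has_integral Beta (1/4) (1/4) / 4 / c) {0<..}"
proof -
  let ?f = "\<lambda>x::real. 1 / sqrt (x ^ 4 + 1)" and ?B = "Beta (1/4) (1/4) / 4 :: real"
  have "((\<lambda>x. \<bar>1 / c\<bar> * ?f (x / c)) has_integral ?B) {0<..} \<longleftrightarrow> (?f has_integral ?B) {0<..}"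
  proof (rule has_integral_change_of_variables_nonneg)
    show "((\<lambda>x. x / c) has_field_derivative 1 / c) (at x within {0<..})" for x
      using c by (auto intro!: derivative_eq_intros)
    show "(\<lambda>x. x / c) ` {0<..} = {0<..}"
    proof (intro equalityI subsetI)
      fix y :: real assume "y \<in> {0<..}"
      then show "y \<in> (\<lambda>x. x / c) ` {0<..}" using c by (intro image_eqI[of _ _ "y * c"]) auto
    qed (use c in auto)
  qed (use c in \<open>auto simp: inj_on_def\<close>)
  then have B: "((\<lambda>x. \<bar>1 / c\<bar> * ?f (x / c)) has_integral ?B) {0<..}"
    using has_integral_quartic by blast
  have "1 / c * (\<bar>1 / c\<bar> * ?f (x / c)) = 1 / sqrt (x ^ 4 + (c\<^sup>2)\<^sup>2)" for x
  proof -
    have "(x / c) ^ 4 + 1 = (x ^ 4 + (c\<^sup>2)\<^sup>2) / (c\<^sup>2)\<^sup>2"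
      using c by (simp add: field_simps power2_eq_square power4_eq_xxxx)
    moreover have "sqrt ((c\<^sup>2)\<^sup>2) = c * c" using c by (simp add: power2_eq_square)
    ultimately have "sqrt ((x / c) ^ 4 + 1) = sqrt (x ^ 4 + (c\<^sup>2)\<^sup>2) / (c * c)"
      by (simp only: real_sqrt_divide)
    then show ?thesis using c by simp
  qed
  with has_integral_mult_right[OF B, of "1 / c"] show ?thesis by (simp add: mult.commute)
qed

lemma theta4_le_theta3: "t > 0 \<Longrightarrow> theta4 t \<le> theta3 t"
  using theta3_dissect[of t] theta_pos[of "4 * t" "1/2"] by (simp add: theta4_def)

text \<open>At the fixed point 1 of the inversion \<open>theta2\<close> and \<open>theta4\<close>
  agree, so Jacobi's identity has two equal terms.\<close>

lemma theta4_1_sq: "(theta4 1)\<^sup>2 = (theta3 1)\<^sup>2 / sqrt 2"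
proof -
  have "2 * theta4 1 ^ 4 = theta3 1 ^ 4"
    using theta_quartic[of 1] theta2_inverse[of 1] by simp
  then have "((theta4 1)\<^sup>2)\<^sup>2 = ((theta3 1)\<^sup>2 / sqrt 2)\<^sup>2"
    by (simp add: power_divide)
  then show ?thesis by (rule power2_eq_imp_eq) auto
qed

text \<open>Landen's transformation makes the integral of \<open>E\<close> at
  \<open>theta3 ^ 2\<close>, \<open>theta4 ^ 2\<close> invariant under doubling. Both parameters
  tend to 1, so its value is \<open>pi / 2\<close>; at the start it is a Beta integral.\<close>

lemma theta3_1_Beta: "(theta3 1)\<^sup>2 = Beta (1/4) (1/4) / (2 * pi)"
proof -
  define c where "c = (theta3 1)\<^sup>2"
  define V where "V = Beta (1/4) (1/4) / 4 / c"
  have c: "c > 0" using theta_pos[of 1 0] by (simp add: c_def)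
  define E where "E = (\<lambda>a b x::real. 1 / sqrt ((x\<^sup>2 + a\<^sup>2) * (x\<^sup>2 + b\<^sup>2)))"
  have E: "(E ((theta3 (2 ^ n))\<^sup>2) ((theta4 (2 ^ n))\<^sup>2) has_integral V) {0<..}" for n
  proof (induction n)
    case 0
    \<comment> \<open>The pure quartic is the case \<open>s = 0\<close>, \<open>r = c ^ 2\<close>;
      the second factor that Landen produces there is the one belonging to
      \<open>theta4 1\<close>.\<close>
    have b: "((theta4 1)\<^sup>2)\<^sup>2 = (0 + 2 * c\<^sup>2) / 4"
      unfolding theta4_1_sq c_def by (simp add: power_divide)
    have "((\<lambda>t. 1 / sqrt ((t\<^sup>2 + c\<^sup>2) * (t\<^sup>2 + (0 + 2 * c\<^sup>2) / 4))) has_integral V) {0<..}"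
      using has_integral_quartic_scaled[OF c] c unfolding V_def
      by (intro has_integral_landen) auto
    then show ?case unfolding E_def power_0 b c_def[symmetric] .
  next
    case (Suc n)
    define t :: real where "t = 2 ^ n"
    have t: "t > 0" by (simp add: t_def)
    define a b where "a = (theta3 t)\<^sup>2" and "b = (theta4 t)\<^sup>2"
    have ab: "a > 0" "b > 0" using theta_pos[OF t, of 0] theta4_pos[OF t] by (auto simp: a_def b_def)
    \<comment> \<open>Expanded, this is Landen's quartic with \<open>r = a * b\<close> and
      \<open>s = a ^ 2 + b ^ 2\<close>. The new parameters are then the squares of the geometric and
      the arithmetic mean.\<close>
    have "E a b = (\<lambda>x. 1 / sqrt (x ^ 4 + (a\<^sup>2 + b\<^sup>2) * x\<^sup>2 + (a * b)\<^sup>2))"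
      unfolding E_def by (intro ext arg_cong[of _ _ "\<lambda>z. 1 / sqrt z"])
        (simp add: power2_eq_square power4_eq_xxxx algebra_simps)
    then have "((\<lambda>t. 1 / sqrt ((t\<^sup>2 + a * b) * (t\<^sup>2 + (a\<^sup>2 + b\<^sup>2 + 2 * (a * b)) / 4))) has_integral V) {0<..}"
      using Suc ab unfolding a_def[symmetric] b_def[symmetric] t_def[symmetric]
      by (intro has_integral_landen) (auto intro!: add_pos_pos)
    moreover have m4: "((theta4 (2 * t))\<^sup>2)\<^sup>2 = a * b"
      unfolding theta4_double[OF t] by (simp add: a_def b_def power_mult_distrib)
    moreover have m3: "((theta3 (2 * t))\<^sup>2)\<^sup>2 = (a\<^sup>2 + b\<^sup>2 + 2 * (a * b)) / 4"
    proof -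
      have "(theta3 (2 * t))\<^sup>2 = (a + b) / 2"
        using theta3_sq[OF t] theta4_sq[OF t] by (simp add: a_def b_def)
      then have eq: "((theta3 (2 * t))\<^sup>2)\<^sup>2 = ((a + b) / 2)\<^sup>2" by (rule arg_cong)
      show ?thesis unfolding eq by (simp add: power_divide power2_sum algebra_simps)
    qed
    moreover have "E ((theta3 (2 * t))\<^sup>2) ((theta4 (2 * t))\<^sup>2)
        = (\<lambda>t. 1 / sqrt ((t\<^sup>2 + a * b) * (t\<^sup>2 + (a\<^sup>2 + b\<^sup>2 + 2 * (a * b)) / 4)))"
      unfolding E_def m3 m4 by (intro ext) (simp only: mult.commute)
    ultimately show ?case unfolding power_Suc t_def[symmetric] by simp
  qed
  \<comment> \<open>\<open>E a b\<close> lies between the integrands in which both parameters equal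
    the larger or the smaller one.\<close>
  have bounds: "pi / (2 * (theta3 (2 ^ n))\<^sup>2) \<le> V \<and> V \<le> pi / (2 * (theta4 (2 ^ n))\<^sup>2)" for n
  proof -
    define a b where "a = (theta3 (2 ^ n))\<^sup>2" and "b = (theta4 (2 ^ n))\<^sup>2"
    have ab: "a > 0" "b > 0" "b \<le> a"
      using theta_pos[of "2 ^ n" 0] theta4_pos[of "2 ^ n"] theta4_le_theta3[of "2 ^ n"]
      by (auto simp: a_def b_def intro!: power_mono)
    have ba: "b\<^sup>2 \<le> a\<^sup>2" using ab by (intro power_mono) auto
    have lo: "1 / (x\<^sup>2 + a\<^sup>2) \<le> E a b x" and hi: "E a b x \<le> 1 / (x\<^sup>2 + b\<^sup>2)" for x
    proof -
      have pos: "0 < x\<^sup>2 + a\<^sup>2" "0 < x\<^sup>2 + b\<^sup>2" using ab by (auto intro: add_nonneg_pos)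
      have "sqrt ((x\<^sup>2 + a\<^sup>2) * (x\<^sup>2 + b\<^sup>2)) \<le> sqrt ((x\<^sup>2 + a\<^sup>2) * (x\<^sup>2 + a\<^sup>2))"
        using pos ba by (intro real_sqrt_le_mono mult_left_mono) auto
      also have "\<dots> = x\<^sup>2 + a\<^sup>2" using pos by simp
      finally show "1 / (x\<^sup>2 + a\<^sup>2) \<le> E a b x"
        unfolding E_def using pos by (intro divide_left_mono) auto
      have "sqrt ((x\<^sup>2 + b\<^sup>2) * (x\<^sup>2 + b\<^sup>2)) \<le> sqrt ((x\<^sup>2 + a\<^sup>2) * (x\<^sup>2 + b\<^sup>2))"
        using pos ba by (intro real_sqrt_le_mono mult_right_mono) auto
      moreover have "sqrt ((x\<^sup>2 + b\<^sup>2) * (x\<^sup>2 + b\<^sup>2)) = x\<^sup>2 + b\<^sup>2" using pos by simp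
      ultimately show "E a b x \<le> 1 / (x\<^sup>2 + b\<^sup>2)"
        unfolding E_def using pos by (intro divide_left_mono) auto
    qed
    have "pi / (2 * a) \<le> V"
      by (rule has_integral_le[OF has_integral_inverse_square[OF ab(1)] E[of n, folded a_def b_def] lo])
    moreover have "V \<le> pi / (2 * b)"
      by (rule has_integral_le[OF E[of n, folded a_def b_def] has_integral_inverse_square[OF ab(2)] hi])
    ultimately show ?thesis by (simp add: a_def b_def)
  qed
  have pow: "filterlim (\<lambda>n. (2::real) ^ n) at_top sequentially"
    using filterlim_two_power_mult[of 1] by simp
  have "(\<lambda>n. pi / (2 * (theta3 (2 ^ n))\<^sup>2)) \<longlonglongrightarrow> pi / (2 * 1\<^sup>2)"
    by (intro tendsto_intros filterlim_compose[OF theta3_tendsto pow]) auto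
  from LIMSEQ_le_const2[OF this, of V] have "pi / 2 \<le> V" using bounds by auto
  have "(\<lambda>n. pi / (2 * (theta4 (2 ^ n))\<^sup>2)) \<longlonglongrightarrow> pi / (2 * 1\<^sup>2)"
    by (intro tendsto_intros filterlim_compose[OF theta4_tendsto pow]) auto
  from LIMSEQ_le_const[OF this, of V] have "V \<le> pi / 2" using bounds by auto
  with \<open>pi / 2 \<le> V\<close> have "V = pi / 2" by simp
  then show ?thesis using c by (simp add: V_def c_def field_simps)
qed

text \<open>The Beta value is \<open>Gamma (1/4) ^ 2 / sqrt pi\<close>, and the reflection formula
  trades \<open>Gamma (1/4)\<close> for \<open>Gamma (3/4)\<close>.\<close>

lemma theta3_1: "theta3 1 = pi powr (1/4) / Gamma (3/4)"
proof -
  have "complex_of_real (Gamma (1/4) * Gamma (3/4)) = of_real (pi / sin (pi / 4))"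
    using Gamma_reflection_complex[of "of_real (1/4)"]
    by (simp add: Gamma_complex_of_real[symmetric] sin_of_real[symmetric])
  then have "Gamma (1/4 :: real) * Gamma (3/4) = pi / sin (pi / 4)"
    by (simp only: of_real_eq_iff)
  moreover have "pi / sin (pi / 4) = pi * (2 / sqrt 2)"
    by (simp add: sin_45)
  moreover have "2 / sqrt 2 = sqrt 2" by (rule real_div_sqrt) simp
  moreover have pos: "Gamma (3/4 :: real) > 0" by (rule Gamma_real_pos) simp
  then have "Gamma (3/4 :: real) \<noteq> 0" by (rule less_imp_neq[symmetric])
  ultimately have G: "Gamma (1/4 :: real) = pi * sqrt 2 / Gamma (3/4)"
    by (simp add: nonzero_eq_divide_eq)
  have "(theta3 1)\<^sup>2 = (Gamma (1/4))\<^sup>2 / (2 * pi * sqrt pi)"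
    using theta3_1_Beta Gamma_one_half_real by (simp add: Beta_def power2_eq_square mult_ac)
  also have "\<dots> = sqrt pi / (Gamma (3/4))\<^sup>2"
  proof -
    have "(Gamma (1/4))\<^sup>2 / (2 * pi * sqrt pi) = pi / sqrt pi / (Gamma (3/4))\<^sup>2"
      unfolding G by (simp add: power_divide power_mult_distrib power2_eq_square[of pi])
    then show ?thesis by (simp only: real_div_sqrt pi_ge_zero)
  qed
  also have "\<dots> = (pi powr (1/4) / Gamma (3/4))\<^sup>2"
  proof -
    have "(pi powr (1/4))\<^sup>2 = sqrt pi"
      by (simp add: powr_half_sqrt[symmetric] powr_powr flip: powr_numeral)
    then show ?thesis by (simp add: power_divide)
  qed
  finally show ?thesis
    by (rule power2_eq_imp_eq) (use theta_pos[of 1 0] pos in auto)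
qed

subsection \<open>Theta constants at 3 and the series\<close>

text \<open>Dissecting \<open>theta3 (1/3)\<close> by 3 and inverting it gives two expressions,
  which determine \<open>theta 3 (1/3)\<close> from \<open>theta3 3\<close>. The tetracode relation
  at \<open>1/3\<close> then brings in \<open>theta3 1\<close>.\<close>

lemma theta3_3: "theta3 1 ^ 4 = 3 * (2 * sqrt 3 - 3) * theta3 3 ^ 4"
proof -
  define u b where "u = sqrt 3" and "b = theta3 3"
  have u: "u * u = 3" by (simp add: u_def)
  have "theta3 (1/3) = b + 2 * theta 3 (1/3)"
    using theta_dissect3[of "1/3" 0] theta_reflect[of "2/3" "1/3" 3] by (simp add: b_def)
  then have T: "2 * theta 3 (1/3) = (u - 1) * b"
    using theta3_inverse[of 3] by (simp add: u_def b_def algebra_simps)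
  have "theta3 1 ^ 4 = b ^ 4 + b * (2 * theta 3 (1/3)) ^ 3"
    using theta_tetracode[of "1/3"] by (simp add: b_def power_mult_distrib)
  also have "\<dots> = (u * (u * u) - 3 * (u * u) + 3 * u) * b ^ 4"
    unfolding T by (simp add: power3_eq_cube power4_eq_xxxx algebra_simps)
  finally show ?thesis unfolding u by (simp add: u_def b_def algebra_simps)
qed

text \<open>Decides which root is which in \<open>theta_3_values\<close>. A termwise bound by shifts
  \<open>1/6\<close> and \<open>5/6\<close> and the dissection of \<open>theta2 (1/3)\<close> give
  \<open>2 * theta2 3 \<le> sqrt 3 * theta4 3\<close>, and \<open>sqrt 3 < 2\<close>.\<close>

lemma theta2_3_less_theta4_3: "theta2 3 < theta4 3"
proof -
  have "theta2 3 \<le> theta 3 (1/6) + theta 3 (5/6)"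
  proof (rule has_sum_mono[OF has_sum_theta has_sum_add[OF has_sum_theta has_sum_theta]])
    fix n :: int
    show "exp (- (pi * 3 * (of_int n + 1/2)\<^sup>2))
        \<le> exp (- (pi * 3 * (of_int n + 1/6)\<^sup>2)) + exp (- (pi * 3 * (of_int n + 5/6)\<^sup>2))"
    proof (cases "n \<ge> 0")
      \<comment> \<open>For \<open>n \<ge> 0\<close> the shift \<open>1/6\<close> is closer to zero
        than \<open>1/2\<close>; for negative \<open>n\<close> the shift \<open>5/6\<close>
        is.\<close>
      case True
      then have "0 \<le> real_of_int n" by simp
      then have "(of_int n + 1/6)\<^sup>2 \<le> (of_int n + 1/2 :: real)\<^sup>2" by (intro power_mono) auto
      then show ?thesis by (intro add_increasing2) auto
    next
      case False
      then have "real_of_int n \<le> real_of_int (- 1)" by (simp only: of_int_le_iff)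
      then have "(- (of_int n + 5/6))\<^sup>2 \<le> (- (of_int n + 1/2) :: real)\<^sup>2" by (intro power_mono) auto
      then show ?thesis unfolding power2_minus by (intro add_increasing) auto
    qed
  qed auto
  then have "theta2 3 \<le> 2 * theta 3 (1/6)"
    using theta_reflect[of "5/6" "1/6" 3] by simp
  moreover have "theta2 (1/3) = theta2 3 + 2 * theta 3 (1/6)"
    using theta_dissect3[of "1/3" "1/2"] theta_reflect[of "5/6" "1/6" 3] by simp
  ultimately have "2 * theta2 3 \<le> sqrt 3 * theta4 3"
    using theta2_inverse[of 3] by simp
  moreover have "sqrt 3 * theta4 3 < 2 * theta4 3"
    using theta4_pos[of 3] by (intro mult_strict_right_mono real_less_lsqrt) auto
  ultimately show ?thesis by simp
qed

text \<open>The cubic modular equation at 1 gives the sum \<open>a + c\<close>, since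
  \<open>theta2 1 = theta4 1\<close>; Jacobi's identity gives \<open>a ^ 4 + c ^ 4\<close>. Sum and
  product then determine \<open>a\<close> and \<open>c\<close> up to order.\<close>

lemma theta_3_values:
  obtains k where "k > 0" "k\<^sup>2 = sqrt 2"
    "theta2 3 = theta3 3 * k * (1 - sqrt (2 * sqrt 3 - 3)) / 2"
    "theta4 3 = theta3 3 * k * (1 + sqrt (2 * sqrt 3 - 3)) / 2"
    "theta2 3 * theta4 3 = (theta3 3)\<^sup>2 * sqrt 2 * (2 - sqrt 3) / 2"
proof -
  define a b c u w where "a = theta2 3" and "b = theta3 3" and "c = theta4 3"
    and "u = sqrt 3" and "w = sqrt (2 * sqrt 3 - 3)"
  have pos: "a > 0" "b > 0" "c > 0"
    using theta_pos[of 3] theta4_pos[of 3] by (auto simp: a_def b_def c_def)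
  have ac: "a < c" using theta2_3_less_theta4_3 by (simp add: a_def c_def)
  have u: "u\<^sup>2 = 3" "u > 3/2"
    unfolding u_def by (simp, rule real_less_rsqrt, simp add: power2_eq_square)
  have w: "w\<^sup>2 = 2 * u - 3" "w > 0" using u by (auto simp: w_def u_def)
  define k where "k = theta3 1 / theta4 1"
  have k: "k > 0" using theta_pos[of 1 0] theta4_pos[of 1] by (simp add: k_def)
  have k2: "k\<^sup>2 = sqrt 2"
    using theta4_1_sq theta_pos[of 1 0] by (simp add: k_def power_divide)
  have "theta4 1 * a + theta4 1 * c = theta3 1 * b"
    using theta_cubic_modular[of 1] theta2_inverse[of 1] by (simp add: a_def b_def c_def)
  then have sum: "a + c = k * b"
    using theta4_pos[of 1] by (simp add: k_def field_simps)
  have quart: "a ^ 4 + c ^ 4 = b ^ 4"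
    using theta_quartic[of 3] by (simp add: a_def b_def c_def)
  define B p where "B = (a + c)\<^sup>2" and "p = a * c"
  have "B\<^sup>2 = (sqrt 2)\<^sup>2 * (b\<^sup>2)\<^sup>2"
    unfolding B_def sum power_mult_distrib k2 ..
  then have "B\<^sup>2 = 2 * b ^ 4" by simp
  moreover have "B\<^sup>2 - 4 * B * p + 2 * p\<^sup>2 = b ^ 4"
    unfolding quart[symmetric] B_def p_def
    by (simp add: power2_eq_square power4_eq_xxxx algebra_simps)
  \<comment> \<open>Eliminating \<open>b\<close> leaves a homogeneous quadratic in \<open>B\<close>
    and \<open>p\<close>, here with the square completed.\<close>
  ultimately have "(2 * (B - p))\<^sup>2 = 3 * B\<^sup>2"
    by (simp add: power2_diff power_mult_distrib)
  then have "(2 * (B - p))\<^sup>2 = (u * B)\<^sup>2"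
    unfolding power_mult_distrib u(1) .
  moreover have "B - p \<ge> 0"
    unfolding B_def p_def using pos by (simp add: power2_sum)
  ultimately have "2 * (B - p) = u * B"
    by (intro power2_eq_imp_eq[of "2 * (B - p)"]) (use u in \<open>auto simp: B_def\<close>)
  then have p: "p = B * (2 - u) / 2" by (simp add: algebra_simps)
  have "(c - a)\<^sup>2 = B - 4 * p"
    unfolding B_def p_def by (simp add: power2_sum power2_diff)
  also have "\<dots> = (k * b)\<^sup>2 * w\<^sup>2"
    unfolding p w(1) B_def sum by (simp add: field_simps)
  also have "\<dots> = (k * b * w)\<^sup>2" by (simp only: power_mult_distrib)
  finally have diff: "c - a = k * b * w"
    by (rule power2_eq_imp_eq) (use ac pos k w in auto)
  show ?thesis
  proof (rule that[OF k k2])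
    show "theta2 3 = theta3 3 * k * (1 - sqrt (2 * sqrt 3 - 3)) / 2"
      "theta4 3 = theta3 3 * k * (1 + sqrt (2 * sqrt 3 - 3)) / 2"
      unfolding a_def[symmetric] b_def[symmetric] c_def[symmetric] w_def[symmetric]
      using sum diff by (simp_all add: algebra_simps)
    show "theta2 3 * theta4 3 = (theta3 3)\<^sup>2 * sqrt 2 * (2 - sqrt 3) / 2"
      unfolding a_def[symmetric] b_def[symmetric] c_def[symmetric] p_def[symmetric] u_def[symmetric] p
      unfolding B_def sum power_mult_distrib k2 by simp
  qed
qed

section \<open>The two series as theta values, by completing the square in the exponent\<close>

lemma epsilon_exponent:
  "- (pi * of_int (k * (3 * k + 1) div 2)) = pi / 24 + - (pi * (3/2) * (of_int k + 1/6)\<^sup>2)"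
proof -
  define m where "m = k * (3 * k + 1) div 2"
  have "k * (3 * k + 1) = 2 * m" by (simp add: m_def)
  from arg_cong[OF this, of real_of_int] have e: "real_of_int m = of_int k * (3 * of_int k + 1) / 2" by simp
  show ?thesis unfolding m_def[symmetric] e by (simp add: power2_eq_square field_simps)
qed

lemma epsilon_term:
  "exp (- pi) powi (k * (3 * k + 1) div 2) = exp (pi / 24) * exp (- (pi * (3/2) * (of_int k + 1/6)\<^sup>2))"
proof -
  have "exp (- pi) powi (k * (3 * k + 1) div 2) = exp (- (pi * of_int (k * (3 * k + 1) div 2)))"
    by (simp add: exp_power_int mult.commute)
  then show ?thesis unfolding epsilon_exponent exp_add .
qed

lemma epsilon_of_real:
  assumes "((\<lambda>k. q powi (k * (3 * k + 1) div 2)) has_sum S) UNIV"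
  shows "epsilon (complex_of_real q) = complex_of_real S"
proof -
  have "((\<lambda>k. complex_of_real (q powi (k * (3 * k + 1) div 2))) has_sum of_real S) UNIV"
    by (rule has_sum_of_real[OF assms])
  from infsumI[OF this] show ?thesis by (simp add: epsilon_def)
qed

lemma epsilon_exp_minus_pi:
  "epsilon (complex_of_real (exp (- pi))) = complex_of_real (exp (pi / 24) * theta (3/2) (1/6))"
  by (rule epsilon_of_real, unfold epsilon_term)
    (intro has_sum_cmult_right has_sum_theta, simp)

text \<open>The sign of the \<open>k\<close>-th term has period 4 in \<open>k\<close>, namely +, +,
  -, -. Splitting modulo 4 multiplies \<open>3/2\<close> by 16 and gives the four shifts over 24
  that occur in \<open>theta_24\<close>.\<close>

lemma epsilon_minus_exp_minus_pi:
  "epsilon (complex_of_real (- exp (- pi)))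
    = complex_of_real (exp (pi / 24) * (theta_eighth (8/3) + theta_eighth 24))"
proof (rule epsilon_of_real)
  define m where "m = (\<lambda>k::int. k * (3 * k + 1) div 2)"
  define F where "F = (\<lambda>k::int. (-1) powi m k * exp (- (pi * (3/2) * (of_int k + 1/6)\<^sup>2)))"
  have eq: "(- exp (- pi)) powi m k = exp (pi / 24) * F k" for k
  proof -
    have "(- exp (- pi)) powi m k = (-1) powi m k * exp (- pi) powi m k"
      using power_int_mult_distrib[of "-1" "exp (- pi)" "m k"] by simp
    then show ?thesis using epsilon_term[of k] by (simp add: F_def m_def)
  qed
  have "F summable_on UNIV"
  proof (rule abs_summable_summable)
    have "norm (F k) = exp (- (pi * (3/2) * (of_int k + 1/6)\<^sup>2))" for k
      by (simp add: F_def abs_mult power_int_abs)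
    then show "(\<lambda>k. norm (F k)) summable_on UNIV"
      using summable_on_theta[of "3/2" "1/6"] by simp
  qed
  then obtain S where S: "(F has_sum S) UNIV" by (auto simp: summable_on_def)
  have half: "m k = M" if "k * (3 * k + 1) = 2 * M" for k M
    using that by (simp add: m_def)
  \<comment> \<open>The exponents written as even or odd numbers, to read off the sign on each
    residue class.\<close>
  have m: "m (4 * j) = 2 * (j * (12 * j + 1))" "m (4 * j + 1) = 2 * ((4 * j + 1) * (3 * j + 1))"
    "m (4 * j + 2) = 2 * (12 * j\<^sup>2 + 13 * j + 3) + 1" "m (4 * j + 3) = 2 * (12 * j\<^sup>2 + 19 * j + 7) + 1" for j
    by (rule half, simp add: algebra_simps power2_eq_square)+
  have sgn: "(-1::real) powi (2 * n) = 1" "(-1::real) powi (2 * n + 1) = -1" for n :: int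
    by (simp_all add: power_int_minus_left)
  have part: "((\<lambda>j. exp (- (pi * (3/2) * (of_int (4 * j + i) + 1/6)\<^sup>2))) has_sum
      theta 24 ((of_int i + 1/6) / 4)) UNIV" for i :: int
  proof -
    have eq: "pi * (3/2) * (of_int (4 * j + i) + 1/6)\<^sup>2 = pi * 24 * (of_int j + (of_int i + 1/6) / 4)\<^sup>2" for j
      by (simp add: power2_eq_square field_simps)
    show ?thesis unfolding eq by (rule has_sum_theta) simp
  qed
  let ?P = "\<lambda>r. (if r < 2 then 1 else -1) * theta 24 ((of_int (int r) + 1/6) / 4)"
  have "S = (\<Sum>r<4. ?P r)"
  proof (rule has_sum_int_residues[OF S])
    fix r :: nat assume "r < 4"
    then have "r \<in> {0, 1, 2, 3}" by auto
    then have "F (int 4 * j + int r) = (if r < 2 then 1 else -1)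
        * exp (- (pi * (3/2) * (of_int (4 * j + int r) + 1/6)\<^sup>2))" for j
      unfolding F_def using m[of j] by (auto simp: sgn)
    then show "((\<lambda>j. F (int 4 * j + int r)) has_sum ?P r) UNIV"
      using has_sum_cmult_right[OF part[of "int r"]] by simp
  qed simp
  then have "S = theta 24 (1/24) + theta 24 (7/24) - theta 24 (13/24) - theta 24 (19/24)"
    by (simp add: numeral_eq_Suc)
  then have S_eq: "S = theta_eighth (8/3) + theta_eighth 24"
    using theta_24[of "8/3"] theta_reflect[of "13/24" "11/24" 24] theta_reflect[of "19/24" "5/24" 24]
    by simp
  from has_sum_cmult_right[OF S, of "exp (pi / 24)"]
  show "((\<lambda>k. (- exp (- pi)) powi (k * (3 * k + 1) div 2)) has_sum
      exp (pi / 24) * (theta_eighth (8/3) + theta_eighth 24)) UNIV"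
    unfolding eq[unfolded m_def] S_eq .
qed

text \<open>The dissection of \<open>theta2 (1/6)\<close> isolates twice the wanted value as
  \<open>sqrt 6 * theta4 6 - theta2 (3/2)\<close>. Both squares come from the theta constants at 3
  by the doubling formulas.\<close>

lemma theta_sixth_power4:
  fixes s :: real
  assumes s: "s > 0" "s ^ 4 = 3"
  shows "theta (3/2) (1/6) ^ 4 = theta3 1 ^ 4 * (sqrt 2 / 12 * (1 + sqrt 2 / s)\<^sup>2)"
proof -
  define u w where "u = sqrt 3" and "w = sqrt (2 * sqrt 3 - 3)"
  have u: "u = s\<^sup>2" unfolding u_def using s by (intro real_sqrt_unique) auto
  have u2: "u * u = 3" "u > 1" by (auto simp: u_def)
  have w2: "w\<^sup>2 = 2 * u - 3" and w: "w > 0"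
  proof -
    have "3 / 2 < u" unfolding u_def by (rule real_less_rsqrt) (simp add: power2_eq_square)
    then show "w\<^sup>2 = 2 * u - 3" "w > 0" unfolding w_def u_def[symmetric] by simp_all
  qed
  have "w\<^sup>2 = (s * (u - 1) / sqrt 2)\<^sup>2"
  proof -
    have "(s * (u - 1) / sqrt 2)\<^sup>2 = u * (u * u - 2 * u + 1) / 2"
      by (simp add: power_divide power_mult_distrib u[symmetric] power2_diff)
        (simp add: power2_eq_square algebra_simps)
    also have "\<dots> = u * (4 - 2 * u) / 2"
      unfolding u2(1) by simp
    also have "\<dots> = 2 * u - u * u" by (simp add: field_simps)
    finally show ?thesis unfolding u2(1) w2 ..
  qed
  \<comment> \<open>The nested radical is resolved with the fourth root \<open>s\<close> of
    3.\<close>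
  then have ws: "w = s * (u - 1) / sqrt 2"
    by (rule power2_eq_imp_eq) (use w s u2 in auto)
  obtain k where k: "k > 0" "k\<^sup>2 = sqrt 2"
    and a: "theta2 3 = theta3 3 * k * (1 - w) / 2"
    and c: "theta4 3 = theta3 3 * k * (1 + w) / 2"
    and ac: "theta2 3 * theta4 3 = (theta3 3)\<^sup>2 * sqrt 2 * (2 - u) / 2"
    using theta_3_values unfolding w_def u_def by metis
  define b X y z where "b = theta3 3" and "X = theta (3/2) (1/6)"
    and "y = theta4 6" and "z = theta2 (3/2)"
  have b: "b > 0" using theta_pos[of 3 0] by (simp add: b_def)
  have yz: "y > 0" "z > 0" using theta4_pos[of 6] theta_pos[of "3/2" "1/2"] by (auto simp: y_def z_def)
  have X: "2 * X = sqrt 6 * y - z"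
    using theta_dissect3[of "1/6" "1/2"] theta_reflect[of "5/6" "1/6" "3/2"] theta2_inverse[of 6]
    by (simp add: X_def y_def z_def)
  have y2: "y\<^sup>2 = b\<^sup>2 * k * (1 + w) / 2"
    using theta4_double[of 3] c by (simp add: y_def b_def power2_eq_square)
  have z2: "z\<^sup>2 = b\<^sup>2 * k * (1 - w)"
    using theta2_sq[of "3/2"] a by (simp add: z_def b_def power2_eq_square)
  have "(sqrt 6 * y * z)\<^sup>2 = (b\<^sup>2 * k * u * (u - 1))\<^sup>2"
  proof -
    have "(sqrt 6 * y * z)\<^sup>2 = 6 * y\<^sup>2 * z\<^sup>2" by (simp add: power_mult_distrib)
    also have "\<dots> = 12 * b\<^sup>2 * (theta2 3 * theta4 3)"
      unfolding y2 z2 a c by (simp add: b_def power2_eq_square field_simps)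
    also have "\<dots> = (b\<^sup>2)\<^sup>2 * k\<^sup>2 * (3 * (4 - 2 * u))"
      unfolding ac k(2) by (simp add: b_def power2_eq_square field_simps)
    \<comment> \<open>By \<open>u * u = 3\<close> this factor is the square of
      \<open>u * (u - 1)\<close>, so the cross term has an explicit root.\<close>
    also have "3 * (4 - 2 * u) = u * u * (u * u - 2 * u + 1)"
      unfolding u2(1) by simp
    also have "(b\<^sup>2)\<^sup>2 * k\<^sup>2 * (u * u * (u * u - 2 * u + 1)) = (b\<^sup>2 * k * u * (u - 1))\<^sup>2"
      by (simp add: power2_eq_square algebra_simps)
    finally show ?thesis .
  qed
  then have yz': "sqrt 6 * y * z = b\<^sup>2 * k * u * (u - 1)"
    by (rule power2_eq_imp_eq) (use b k u2 yz in auto)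
  have "(2 * X)\<^sup>2 = 6 * y\<^sup>2 + z\<^sup>2 - 2 * (sqrt 6 * y * z)"
    unfolding X by (simp add: power2_diff power_mult_distrib)
  also have "\<dots> = b\<^sup>2 * k * (4 + 2 * w + 2 * u - 2 * (u * u))"
    unfolding yz' y2 z2 by (simp add: algebra_simps)
  finally have X2: "X\<^sup>2 = b\<^sup>2 * k * (w + u - 1) / 2"
    unfolding u2(1) by (simp add: power_mult_distrib algebra_simps)
  have "X ^ 4 = (X\<^sup>2)\<^sup>2" by simp
  also have "\<dots> = b ^ 4 * sqrt 2 * (w + u - 1)\<^sup>2 / 4"
    unfolding X2 power_divide power_mult_distrib k(2) by simp
  \<comment> \<open>The factor \<open>3 * w ^ 2\<close> is inserted to match
    \<open>theta3_3\<close>.\<close>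
  also have "\<dots> = (3 * w\<^sup>2 * b ^ 4) * (sqrt 2 / 12 * ((w + u - 1) / w)\<^sup>2)"
    using w by (simp add: power_divide field_simps)
  also have "3 * w\<^sup>2 * b ^ 4 = theta3 1 ^ 4"
    using theta3_3 by (simp add: w2 u_def b_def)
  also have "(w + u - 1) / w = 1 + sqrt 2 / s"
  proof -
    have "(u - 1) / w = sqrt 2 / s" unfolding ws using s u2 by simp
    then show ?thesis using w by (simp add: add_divide_distrib diff_divide_distrib)
  qed
  finally show ?thesis by (simp add: X_def)
qed

text \<open>Inversion sends \<open>theta2 * theta4\<close> at \<open>1/3\<close> to three times its
  value at 3, so \<open>theta_eighth (8/3)\<close> is \<open>sqrt 3\<close> times
  \<open>theta_eighth 24\<close>, and a single square remains to be evaluated.\<close>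

lemma theta_eighth_sum_power4:
  "(theta_eighth (8/3) + theta_eighth 24) ^ 4 = theta3 1 ^ 4 / (6 * (2 * sqrt 3 - 3))"
proof -
  define u b where "u = sqrt 3" and "b = theta3 3"
  have u: "u * u = 3" "u > 3 / 2" unfolding u_def
    by (simp, rule real_less_rsqrt, simp add: power2_eq_square)
  define p where "p = theta2 3 * theta4 3 / 2"
  have "theta2 3 * theta4 3 = b\<^sup>2 * sqrt 2 * (2 - u) / 2"
    unfolding b_def u_def by (rule theta_3_values)
  then have p: "p = b\<^sup>2 * sqrt 2 * (2 - u) / 4"
    unfolding p_def by (simp only:)
  have 1: "(theta_eighth 24)\<^sup>2 = p"
    using theta_eighth_sq[of 3] by (simp add: p_def)
  have "(theta_eighth (8/3))\<^sup>2 = (u * theta_eighth 24)\<^sup>2"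
    using theta_eighth_sq[of "1/3"] theta2_inverse[of 3] theta4_inverse[of 3]
    unfolding power_mult_distrib 1 by (simp add: p_def u_def power2_eq_square)
  then have "theta_eighth (8/3) = u * theta_eighth 24"
    by (rule power2_eq_imp_eq) (use theta_eighth_pos[of 24] theta_eighth_pos[of "8/3"] u in auto)
  then have "theta_eighth (8/3) + theta_eighth 24 = (1 + u) * theta_eighth 24"
    by (simp add: algebra_simps)
  then have "(theta_eighth (8/3) + theta_eighth 24) ^ 4 = ((1 + u)\<^sup>2 * (theta_eighth 24)\<^sup>2)\<^sup>2"
    by (simp add: power_mult_distrib)
  \<comment> \<open>\<open>(1 + u) ^ 2 * (2 - u)\<close> expands to the bracket, which equals 2
    because \<open>u ^ 3 = 3 * u\<close>.\<close>
  also have "(1 + u)\<^sup>2 * (theta_eighth 24)\<^sup>2 = b\<^sup>2 * sqrt 2 * (2 + 3 * u - u * (u * u)) / 4"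
    unfolding 1 p by (simp add: power2_eq_square algebra_simps)
  also have "\<dots> = b\<^sup>2 * sqrt 2 / 2"
    unfolding u(1) by simp
  also have "\<dots>\<^sup>2 = b ^ 4 / 2"
    by (simp add: power_divide power_mult_distrib)
  also have "\<dots> = theta3 1 ^ 4 / (6 * (2 * u - 3))"
    using u theta3_3 unfolding u_def[symmetric] b_def[symmetric] by (simp add: field_simps)
  finally show ?thesis by (simp add: u_def)
qed

theorem theorem4p5:
  shows "epsilon (complex_of_real (exp (- pi))) =
      complex_of_real
        (2 powr (- 9 / 8) * 3 powr (- 3 / 8) * exp (pi / 24)
          * ((1 + sqrt 3 + sqrt 2 * 3 powr (3 / 4))
              / (1 + sqrt 3 + sqrt 2 * root 4 3) powr (1 / 2))
          * (pi powr (1 / 4) / Gamma (3 / 4)))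
  \<and> epsilon (complex_of_real (- exp (- pi))) =
      complex_of_real
        (2 powr (- 3 / 4) * 3 powr (- 1 / 2) * exp (pi / 24)
          * (1 + sqrt 3) * (2 * sqrt 3 - 3) powr (1 / 4)
          * (pi powr (1 / 4) / Gamma (3 / 4)))"
proof -
  define s u where "s = root 4 (3::real)" and "u = sqrt (3::real)"
  have s: "s > 0" "s ^ 4 = 3" by (auto simp: s_def)
  have u: "u = s\<^sup>2" unfolding u_def using s by (intro real_sqrt_unique) auto
  have u2: "u * u = 3" by (simp add: u_def)
  have u3: "u > 3 / 2" unfolding u_def by (rule real_less_rsqrt) (simp add: power2_eq_square)
  have "s = 3 powr (1/4)" by (simp add: s_def root_powr_inverse)
  then have s3: "3 powr (3/4) = s ^ 3"
    by (simp add: powr_powr flip: powr_realpow)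
  have pow4: "(x powr a) ^ 4 = x powr (4 * a)" if "x > 0" for x a :: real
    using that by (simp add: powr_powr mult.commute flip: powr_realpow)
  have pos: "pi powr (1 / 4) / Gamma (3 / 4) > 0"
    using theta_pos[of 1 0] unfolding theta3_1 by simp
  define N M where "N = 1 + u + sqrt 2 * s ^ 3" and "M = 1 + u + sqrt 2 * s"
  have NM: "N > 0" "M > 0"
    using s u3 by (auto simp: N_def M_def intro!: add_pos_pos)
  \<comment> \<open>In the fourth power of \<open>N / M powr (1/2)\<close> this relation cancels
    \<open>M\<close>, leaving \<open>8 * (s + sqrt 2) ^ 2\<close>.\<close>
  have NM2: "N\<^sup>2 = 2 * sqrt 2 * (s + sqrt 2) * M"
  proof -
    have r: "(1 + s * s + r * (s * s * s)) * (1 + s * s + r * (s * s * s))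
        = 2 * r * (s + r) * (1 + s * s + r * s)" if "s * s * s * s = 3" "r * r = 2" for r :: real
    proof -
      have "(1 + s * s + r * (s * s * s)) * (1 + s * s + r * (s * s * s))
          = 1 + 2 * (s * s) + s * s * s * s + 2 * r * (s * s * s) + 2 * r * s * (s * s * s * s)
            + (r * r) * (s * s) * (s * s * s * s)" by (simp add: algebra_simps)
      moreover have "2 * r * (s + r) * (1 + s * s + r * s)
          = 2 * r * s + 2 * r * (s * s * s) + 4 * (r * r) * (s * s) + 2 * (r * r) + 2 * (r * r) * (r * s)"
        by (simp add: algebra_simps)
      ultimately show ?thesis unfolding that by (simp add: algebra_simps)
    qed
    show ?thesis
      using r[of "sqrt 2"] s(2) unfolding N_def M_def u
      by (simp add: power2_eq_square power3_eq_cube power4_eq_xxxx mult.assoc)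
  qed
  \<comment> \<open>Both sides are nonnegative, so it suffices to compare fourth powers, where the
    fractional powers reduce to square roots.\<close>
  have "theta (3/2) (1/6) = 2 powr (- 9 / 8) * 3 powr (- 3 / 8)
      * (N / M powr (1 / 2)) * (pi powr (1 / 4) / Gamma (3 / 4))" (is "_ = ?R * _")
  proof (rule power_eq_imp_eq_base)
    have "2 powr (- 9 / 2) = 1 / (16 * sqrt (2::real))"
      using powr_add[of 2 4 "1/2::real"] by (simp add: powr_minus_divide powr_half_sqrt)
    moreover have "3 powr (- 3 / 2) = 1 / (3 * u)"
      using powr_add[of 3 1 "1/2::real"] by (simp add: powr_minus_divide powr_half_sqrt u_def)
    moreover have "(M powr (1 / 2)) ^ 4 = M\<^sup>2"
      using NM by (simp add: pow4)
    moreover have "N ^ 4 = 8 * (s + sqrt 2)\<^sup>2 * M\<^sup>2"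
    proof -
      have "N ^ 4 = (N\<^sup>2)\<^sup>2" by simp
      then show ?thesis unfolding NM2 by (simp add: power_mult_distrib)
    qed
    ultimately have "?R ^ 4 = 1 / (16 * sqrt 2) * (1 / (3 * u)) * (8 * (s + sqrt 2)\<^sup>2)"
      using NM by (simp add: power_mult_distrib power_divide pow4)
    also have "\<dots> = sqrt 2 / 12 * (1 + sqrt 2 / s)\<^sup>2"
    proof -
      have 1: "(1 + sqrt 2 / s)\<^sup>2 = (s + sqrt 2)\<^sup>2 / u"
        using s by (simp add: u field_simps power2_eq_square)
      have 2: "sqrt 2 / (12::real) = 1 / (16 * sqrt 2) * (1 / 3) * 8"
        by (simp add: field_simps)
      show ?thesis unfolding 1 2 by simp
    qed
    finally have R4: "?R ^ 4 = sqrt 2 / 12 * (1 + sqrt 2 / s)\<^sup>2" .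
    show "theta (3/2) (1/6) ^ 4 = (?R * (pi powr (1 / 4) / Gamma (3 / 4))) ^ 4"
      unfolding theta_sixth_power4[OF s] theta3_1 power_mult_distrib[of ?R] R4 by (rule mult.commute)
    show "0 \<le> theta (3/2) (1/6)" using theta_pos[of "3/2"] by (simp add: less_imp_le)
    show "0 \<le> ?R * (pi powr (1 / 4) / Gamma (3 / 4))"
      using pos NM by (intro mult_nonneg_nonneg) auto
  qed simp
  moreover have "theta_eighth (8/3) + theta_eighth 24 = 2 powr (- 3 / 4) * 3 powr (- 1 / 2)
      * (1 + u) * (2 * u - 3) powr (1 / 4) * (pi powr (1 / 4) / Gamma (3 / 4))" (is "_ = ?R * _")
  proof (rule power_eq_imp_eq_base)
    have "(2 powr (- 3 / 4)) ^ 4 = 1 / (8::real)" "(3 powr (- 1 / 2)) ^ 4 = 1 / (9::real)"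
      "((2 * u - 3) powr (1 / 4)) ^ 4 = 2 * u - 3"
      using u3 by (subst pow4, simp, simp add: powr_minus_divide)+
    then have "?R ^ 4 = 1 / 8 * (1 / 9) * (1 + u) ^ 4 * (2 * u - 3)"
      unfolding power_mult_distrib by (simp only:)
    also have "(1 + u) ^ 4 = 16 * u + 28"
    proof -
      have "(1 + u) ^ 4 = 1 + 4 * u + 6 * (u * u) + 4 * (u * u) * u + (u * u) * (u * u)"
        by (simp add: power4_eq_xxxx algebra_simps)
      then show ?thesis unfolding u2 by simp
    qed
    also have "1 / 8 * (1 / 9) * (16 * u + 28) * (2 * u - 3) = 1 / (6 * (2 * u - 3))"
    proof -
      \<comment> \<open>Clearing the denominator leaves this product; with \<open>u * u = 3\<close>
        the irrational parts cancel.\<close>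
      have "(16 * u + 28) * ((2 * u - 3) * (2 * u - 3))
          = 64 * u * (u * u) - 80 * (u * u) - 192 * u + 252" by (simp add: algebra_simps)
      then have "(16 * u + 28) * ((2 * u - 3) * (2 * u - 3)) = 12" unfolding u2 by simp
      then show ?thesis using u3 by (simp add: field_simps)
    qed
    finally have R4: "?R ^ 4 = 1 / (6 * (2 * u - 3))" .
    show "(theta_eighth (8/3) + theta_eighth 24) ^ 4 = (?R * (pi powr (1 / 4) / Gamma (3 / 4))) ^ 4"
      unfolding theta_eighth_sum_power4 theta3_1 u_def[symmetric] power_mult_distrib[of ?R] R4 by simp
    show "0 \<le> theta_eighth (8/3) + theta_eighth 24"
      using theta_eighth_pos[of 24] theta_eighth_pos[of "8/3"] by simp
    show "0 \<le> ?R * (pi powr (1 / 4) / Gamma (3 / 4))"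
      using pos u3 by (intro mult_nonneg_nonneg) auto
  qed simp
  ultimately show ?thesis
    unfolding epsilon_exp_minus_pi epsilon_minus_exp_minus_pi s3 s_def[symmetric] u_def[symmetric]
      N_def[symmetric] M_def[symmetric]
    by (simp only: mult_ac simp_thms)
qed

end
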